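(* The following two problems are undecidable: given an integral NMDA $\mathcal{N}$ and an integral DMDA $\mathcal{D}$ over the same alphabet, decide whether $\mathcal{N}(w)\leq\mathcal{D}(w)$ for all finite words $w$; and given such $\mathcal{N}$ and $\mathcal{D}$, decide whether $\mathcal{N}(w)<\mathcal{D}(w)$ for all finite words $w$.
   Context: An alphabet $\Sigma$ is a finite nonempty set; "finite words" range over $\Sigma^+$ (nonempty finite words). An NMDA is a tuple $\mathcal{A}=\langle \Sigma,Q,\iota,\delta,\gamma,\rho\rangle$ with finite state set $Q$, initial states $\iota\subseteq Q$, transition relation $\delta\subseteq Q\times\Sigma\times Q$, weight function $\gamma:\delta\to\mathbb{Q}$ and discount-factor function $\rho:\delta\to\mathbb{Q}\cap(1,\infty)$; NMDAs are assumed complete (every state has at least one outgoing transition on every letter). A run on a word $w=\sigma_0\sigma_1\cdots\sigma_{n-1}$ is $p_0,\sigma_0,p_1,\ldots,p_n$ with $p_0\in\iota$ and $t_i=(p_i,\sigma_i,p_{i+1})\in\delta$; its value is $\sum_{i=0}^{n-1}\gamma(t_i)\prod_{j<i}\frac{1}{\rho(t_j)}$, and $\mathcal{A}(w)$ is the minimum (infimum) of values of runs on $w$. A DMDA is an NMDA with $|\iota|=1$ and at most one successor per state and letter. An NMDA is integral if all discount factors are integers. *)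

theory Defs
  imports Complex_Main "HOL-Library.Extended_Real" "HOL-Library.Nat_Bijection"
begin

section \<open>Discounted-sum automata with multiple discount factors\<close>

type_synonym ('a, 'q) transition = "'q \<times> 'a \<times> 'q"

text \<open>The fields \<open>weight\<close> and \<open>discount\<close> are total functions, but only their values on
  \<open>transitions\<close> are ever used.\<close>

record ('a, 'q) nmda =
  alphabet :: "'a set"
  states :: "'q set"
  initial :: "'q set"
  transitions :: "('a, 'q) transition set"
  weight :: "('a, 'q) transition \<Rightarrow> rat"
  discount :: "('a, 'q) transition \<Rightarrow> rat"

definition is_nmda :: "('a, 'q) nmda \<Rightarrow> bool" where
  "is_nmda A \<longleftrightarrow>
     finite (alphabet A) \<and> alphabet A \<noteq> {} \<and> finite (states A) \<and> initial A \<subseteq> states A \<and>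
     transitions A \<subseteq> states A \<times> alphabet A \<times> states A \<and>
     (\<forall>t\<in>transitions A. discount A t > 1) \<and>
     (\<forall>q\<in>states A. \<forall>a\<in>alphabet A. \<exists>q'. (q, a, q') \<in> transitions A)"

definition is_dmda :: "('a, 'q) nmda \<Rightarrow> bool" where
  "is_dmda A \<longleftrightarrow> is_nmda A \<and> card (initial A) = 1 \<and>
     (\<forall>q a q1 q2. (q, a, q1) \<in> transitions A \<longrightarrow> (q, a, q2) \<in> transitions A \<longrightarrow> q1 = q2)"

definition integral_nmda :: "('a, 'q) nmda \<Rightarrow> bool" where
  "integral_nmda A \<longleftrightarrow> (\<forall>t\<in>transitions A. discount A t \<in> \<int>)"

definition nonempty_words :: "'a set \<Rightarrow> 'a list set" where
  "nonempty_words \<Sigma> = {w. w \<noteq> [] \<and> set w \<subseteq> \<Sigma>}"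

text \<open>A run on a given word is represented by its sequence of states.\<close>

definition step :: "'a list \<Rightarrow> 'q list \<Rightarrow> nat \<Rightarrow> ('a, 'q) transition" where
  "step w ps i = (ps ! i, w ! i, ps ! Suc i)"

definition runs :: "('a, 'q) nmda \<Rightarrow> 'a list \<Rightarrow> 'q list set" where
  "runs A w = {ps. length ps = Suc (length w) \<and> ps ! 0 \<in> initial A \<and>
                   (\<forall>i<length w. step w ps i \<in> transitions A)}"

definition run_value :: "('a, 'q) nmda \<Rightarrow> 'a list \<Rightarrow> 'q list \<Rightarrow> rat" where
  "run_value A w ps =
     (\<Sum>i<length w. weight A (step w ps i) * (\<Prod>j<i. 1 / discount A (step w ps j)))"

text \<open>The extended reals only serve to make the infimum of the empty set be \<open>\<infinity>\<close>; this
  case arises just for an automaton without initial states.\<close>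

definition word_value :: "('a, 'q) nmda \<Rightarrow> 'a list \<Rightarrow> ereal" where
  "word_value A w = (INF ps\<in>runs A w. ereal (of_rat (run_value A w ps)))"


section \<open>Finite descriptions of automata and their codes\<close>

text \<open>A description lists the alphabet, the states, the initial states, and the transitions
  together with their weights and discount factors.  Letters and states are named by
  natural numbers.  If a transition is listed repeatedly, its first entry determines
  weight and discount factor.\<close>

type_synonym nmda_desc =
  "nat list \<times> nat list \<times> nat list \<times> ((nat, nat) transition \<times> rat \<times> rat) list"

fun nmda_of :: "nmda_desc \<Rightarrow> (nat, nat) nmda" where
  "nmda_of (ls, qs, is, ts) =
     \<lparr> alphabet = set ls, states = set qs, initial = set is, transitions = fst ` set ts,
       weight = (\<lambda>t. fst (the (map_of ts t))), discount = (\<lambda>t. snd (the (map_of ts t))) \<rparr>"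

text \<open>Rationals are coded by numerator and denominator in lowest terms.\<close>

definition rat_code :: "rat \<Rightarrow> nat" where
  "rat_code x = (case quotient_of x of (p, q) \<Rightarrow> prod_encode (int_encode p, nat q))"

fun entry_code :: "(nat, nat) transition \<times> rat \<times> rat \<Rightarrow> nat" where
  "entry_code ((p, a, q), x, r) = list_encode [p, a, q, rat_code x, rat_code r]"

fun desc_code :: "nmda_desc \<Rightarrow> nat" where
  "desc_code (ls, qs, is, ts) =
     list_encode [list_encode ls, list_encode qs, list_encode is, list_encode (map entry_code ts)]"

fun pair_code :: "nmda_desc \<times> nmda_desc \<Rightarrow> nat" where
  "pair_code (N, D) = prod_encode (desc_code N, desc_code D)"

lemma inj_rat_code: "inj rat_code"
proof (rule injI)
  fix x y assume "rat_code x = rat_code y"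
  moreover obtain p q where x: "quotient_of x = (p, q)" by (cases "quotient_of x")
  moreover obtain p' q' where y: "quotient_of y = (p', q')" by (cases "quotient_of y")
  ultimately have "p = p'" "nat q = nat q'" by (auto simp: rat_code_def int_encode_eq prod_encode_eq)
  moreover have "q > 0" "q' > 0" using x y by (auto dest: quotient_of_denom_pos)
  ultimately show "x = y" using x y by (auto intro: quotient_of_inject)
qed

lemma inj_entry_code: "inj entry_code"
  by (rule injI) (auto elim!: entry_code.elims simp: list_encode_eq dest: injD[OF inj_rat_code])

lemma inj_desc_code: "inj desc_code"
  by (rule injI)
     (auto elim!: desc_code.elims simp: list_encode_eq inj_map_eq_map[OF inj_entry_code])

lemma inj_pair_code: "inj pair_code"
  by (rule injI)
     (auto elim!: pair_code.elims simp: prod_encode_eq inj_eq[OF inj_desc_code]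
           simp del: desc_code.simps)

lemma description_exists:
  fixes A :: "(nat, nat) nmda"
  assumes "is_nmda A"
  obtains d where "alphabet (nmda_of d) = alphabet A" "states (nmda_of d) = states A"
    "initial (nmda_of d) = initial A" "transitions (nmda_of d) = transitions A"
    "\<And>t. t \<in> transitions A \<Longrightarrow> weight (nmda_of d) t = weight A t"
    "\<And>t. t \<in> transitions A \<Longrightarrow> discount (nmda_of d) t = discount A t"
proof -
  have fin: "finite (alphabet A)" "finite (states A)" "finite (initial A)"
    using assms by (auto simp: is_nmda_def intro: finite_subset)
  have "finite (transitions A)"
    using assms fin finite_subset[of "transitions A" "states A \<times> alphabet A \<times> states A"]
    by (auto simp: is_nmda_def)
  with fin obtain ls qs ini ts where l: "set ls = alphabet A" "set qs = states A"
      "set ini = initial A" "set ts = transitions A"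
    by (metis finite_list)
  let ?d = "(ls, qs, ini, map (\<lambda>t. (t, weight A t, discount A t)) ts)"
  have "map_of (map (\<lambda>t. (t, weight A t, discount A t)) ts) t = Some (weight A t, discount A t)"
    if "t \<in> transitions A" for t
    using that unfolding l(4)[symmetric] by (induction ts) auto
  then show thesis using l by (intro that[of ?d]) (auto simp: image_image)
qed


section \<open>Computability\<close>

text \<open>Partial recursive functions over the natural numbers.  \<open>rec_eval f xs y\<close> means that
  \<open>f\<close> is defined on the arguments \<open>xs\<close> and has the value \<open>y\<close> there.\<close>

datatype recf =
    Zero
  | Succ
  | Proj nat
  | Comp recf "recf list"
  | PrimRec recf recf
  | Mu recf

inductive rec_eval :: "recf \<Rightarrow> nat list \<Rightarrow> nat \<Rightarrow> bool" where
  zero: "rec_eval Zero xs 0"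
| succ: "rec_eval Succ [x] (Suc x)"
| proj: "i < length xs \<Longrightarrow> rec_eval (Proj i) xs (xs ! i)"
| comp: "list_all2 (\<lambda>g y. rec_eval g xs y) gs ys \<Longrightarrow> rec_eval f ys z \<Longrightarrow>
         rec_eval (Comp f gs) xs z"
| prim_0: "rec_eval f xs y \<Longrightarrow> rec_eval (PrimRec f g) (0 # xs) y"
| prim_Suc: "rec_eval (PrimRec f g) (n # xs) y \<Longrightarrow> rec_eval g (n # y # xs) z \<Longrightarrow>
             rec_eval (PrimRec f g) (Suc n # xs) z"
| mu: "rec_eval f (n # xs) 0 \<Longrightarrow> (\<And>m. m < n \<Longrightarrow> \<exists>y>0. rec_eval f (m # xs) y) \<Longrightarrow>
       rec_eval (Mu f) xs n"

inductive_cases rec_eval_elims: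
  "rec_eval Zero xs y" "rec_eval Succ xs y" "rec_eval (Proj i) xs y" "rec_eval (Comp f gs) xs y"
  "rec_eval (PrimRec f g) (0 # xs) y" "rec_eval (PrimRec f g) (Suc n # xs) y" "rec_eval (Mu f) xs y"

lemma rec_eval_deterministic: "rec_eval f xs y \<Longrightarrow> rec_eval f xs y' \<Longrightarrow> y = y'"
proof (induction arbitrary: y' rule: rec_eval.induct)
  case (comp xs gs ys f z)
  from comp.prems obtain ys' where
    ys': "list_all2 (\<lambda>g y. rec_eval g xs y) gs ys'" "rec_eval f ys' y'"
    by (elim rec_eval_elims) auto
  have "ys = ys'"
  proof (rule nth_equalityI)
    show "length ys = length ys'"
      using list_all2_lengthD[OF comp.IH(1)] list_all2_lengthD[OF ys'(1)] by simp
    show "ys ! i = ys' ! i" if "i < length ys" for i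
      using that comp.IH(1) ys'(1) by (auto simp: list_all2_conv_all_nth)
  qed
  then show ?case using comp.IH(2) ys'(2) by simp
next
  case (prim_Suc f g n xs y z)
  from prim_Suc.prems obtain u where "rec_eval (PrimRec f g) (n # xs) u" "rec_eval g (n # u # xs) y'"
    by (elim rec_eval_elims)
  then show ?case using prim_Suc.IH by auto
next
  case (mu f n xs)
  from mu.prems have "rec_eval f (y' # xs) 0 \<and> (\<forall>m<y'. \<exists>y>0. rec_eval f (m # xs) y)"
    by (rule rec_eval_elims(7)) simp
  then have y': "rec_eval f (y' # xs) 0" "\<forall>m<y'. \<exists>y>0. rec_eval f (m # xs) y"
    by simp_all
  have "\<not> y' < n"
  proof
    assume "y' < n"
    from mu.IH(2)[OF this] obtain u where "u > 0" "\<forall>v. rec_eval f (y' # xs) v \<longrightarrow> u = v" by blast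
    with y'(1) show False by auto
  qed
  moreover have "\<not> n < y'"
  proof
    assume "n < y'"
    with y'(2) obtain u where "u > 0" "rec_eval f (n # xs) u" by blast
    with mu.IH(1)[of u] show False by simp
  qed
  ultimately show ?case by simp
next
  case (zero xs)
  then show ?case by (elim rec_eval_elims) simp
next
  case (succ x)
  then show ?case by (elim rec_eval_elims) simp
next
  case (proj i xs)
  from proj.prems show ?case by (elim rec_eval_elims) simp
next
  case (prim_0 f xs y g)
  from prim_0.prems show ?case by (elim rec_eval_elims) (rule prim_0.IH)
qed

text \<open>A decision problem is given by a set of instances, presented to the algorithm through
  their codes, and the set of those instances to be answered positively.  No requirement is
  imposed on how the algorithm behaves on numbers that are not codes of instances.\<close>

definition decidable :: "('i \<Rightarrow> nat) \<Rightarrow> 'i set \<Rightarrow> 'i set \<Rightarrow> bool" where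
  "decidable code inst yes \<longleftrightarrow>
     (\<exists>f. \<forall>x\<in>inst. rec_eval f [code x] (if x \<in> yes then 1 else 0))"


section \<open>Comparison problems\<close>

definition comparison_instances :: "(nmda_desc \<times> nmda_desc) set" where
  "comparison_instances = {(N, D).
     is_nmda (nmda_of N) \<and> integral_nmda (nmda_of N) \<and>
     is_dmda (nmda_of D) \<and> integral_nmda (nmda_of D) \<and>
     alphabet (nmda_of N) = alphabet (nmda_of D)}"

end

theory Submission
  imports Defs "HOL-Library.Countable"
begin

text \<open>
  A counter graph is a finite nondeterministic program whose edges increment, decrement or test
  counters.  With weights derived from a potential on the states, a run ending in \<open>q\<close> has value
  \<open>- pot q / P\<close>, where \<open>P\<close> is the product of its discount factors, so that comparing values
  amounts to comparing such products.  The words are sequences of edges; the deterministic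
  automaton multiplies by 6 on every letter.  The nondeterministic one guesses why the word is
  not an accepting computation: either the edges do not fit together, or some counter \<open>k\<close>
  is misused.  In the latter case it uses the factors 4 and 9 for the increments and decrements
  of \<open>k\<close>, or conversely, until the failing instruction, so that its product differs from that of
  the deterministic automaton by \<open>(2/3)\<^sup>c\<close> or \<open>(3/2)\<^sup>c\<close> for the current value \<open>c\<close> of \<open>k\<close>.
  A small correction at the failing instruction makes the two values differ always, whence both
  comparison problems express non-halting.  The input enters via the factors \<open>4\<^sup>x\<close>, \<open>9\<^sup>x\<close>
  and \<open>6\<^sup>x\<close> of an initial letter.  Since counter graphs implement all partial recursive functions,
  a decision procedure yields a graph that, when run on its own description, halts iff it does
  not halt.
\<close>

section \<open>Counter graphs\<close>

type_synonym store = "nat \<Rightarrow> nat"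

datatype instr = Inc nat | Dec nat | Zer nat | Nop

text \<open>Nodes are lists so that consing a fixed number onto every node name yields a disjoint
  copy of a graph.\<close>

type_synonym edge = "nat list \<times> instr \<times> nat list"

fun exec :: "instr \<Rightarrow> store \<Rightarrow> store \<Rightarrow> bool" where
  "exec (Inc k) v v' \<longleftrightarrow> v' = v(k := Suc (v k))"
| "exec (Dec k) v v' \<longleftrightarrow> v k > 0 \<and> v' = v(k := v k - 1)"
| "exec (Zer k) v v' \<longleftrightarrow> v k = 0 \<and> v' = v"
| "exec Nop v v' \<longleftrightarrow> v' = v"

inductive gstep :: "edge set \<Rightarrow> nat list \<times> store \<Rightarrow> nat list \<times> store \<Rightarrow> bool" for E where
  gstepI: "(p, i, q) \<in> E \<Longrightarrow> exec i v v' \<Longrightarrow> gstep E (p, v) (q, v')"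

lemma gsteps_step:
  "(gstep E)\<^sup>*\<^sup>* c (p, v) \<Longrightarrow> (p, i, q) \<in> E \<Longrightarrow> exec i v v' \<Longrightarrow> (gstep E)\<^sup>*\<^sup>* c (q, v')"
  by (meson gstepI rtranclp.rtrancl_into_rtrancl)

text \<open>The equivalence also speaks about stores without any result: a graph that blocks or
  diverges just fails to reach \<open>t\<close>. Partial functions and nondeterministic relations
  are thus treated alike.\<close>

definition implementable :: "(store \<Rightarrow> store \<Rightarrow> bool) \<Rightarrow> bool" where
  "implementable R \<longleftrightarrow>
     (\<exists>E s t. finite E \<and> (\<forall>v v'. (gstep E)\<^sup>*\<^sup>* (s, v) (t, v') \<longleftrightarrow> R v v'))"

section \<open>Disjoint copies and composition of graphs\<close>

definition shift :: "nat \<Rightarrow> edge set \<Rightarrow> edge set" where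
  "shift n E = (\<lambda>(p, i, q). (n # p, i, n # q)) ` E"

lemma finite_shift [simp]: "finite E \<Longrightarrow> finite (shift n E)"
  by (simp add: shift_def)

lemma shift_iff [simp]:
  "(p, i, q) \<in> shift n E \<longleftrightarrow> (\<exists>p' q'. p = n # p' \<and> q = n # q' \<and> (p', i, q') \<in> E)"
  by (force simp: shift_def)

lemma gsteps_shift:
  assumes "(gstep E)\<^sup>*\<^sup>* c d" "shift n E \<subseteq> E'"
  shows "(gstep E')\<^sup>*\<^sup>* (n # fst c, snd c) (n # fst d, snd d)"
  using assms(1)
proof (induction rule: rtranclp_induct)
  case (step y z)
  from step.hyps(2) have "gstep E' (n # fst y, snd y) (n # fst z, snd z)"
    using assms(2) by (cases rule: gstep.cases) (auto intro!: gstepI)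
  with step.IH show ?case by simp
qed simp

lemma gsteps_shift_pair:
  assumes "(gstep E)\<^sup>*\<^sup>* (p, v) (q, v')" "shift n E \<subseteq> E'"
  shows "(gstep E')\<^sup>*\<^sup>* (n # p, v) (n # q, v')"
  using gsteps_shift[OF assms] by simp

lemma implementable_instr: "implementable (exec i)"
proof -
  let ?E = "{([], i, [0])} :: edge set"
  have reach: "c = ([], v) \<or> (\<exists>v'. c = ([0], v') \<and> exec i v v')" if "(gstep ?E)\<^sup>*\<^sup>* ([], v) c" for v c
    using that by (induction rule: rtranclp_induct) (auto elim!: gstep.cases)
  have "(gstep ?E)\<^sup>*\<^sup>* ([], v) ([0], v') \<longleftrightarrow> exec i v v'" for v v'
    by (auto intro!: r_into_rtranclp gstepI dest: reach)
  then show ?thesis unfolding implementable_def by (intro exI[of _ ?E]) blast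
qed

lemma implementable_skip: "implementable (\<lambda>v v'. v' = v)"
proof -
  have "exec Nop = (\<lambda>v v'. v' = v)" by (simp add: fun_eq_iff)
  then show ?thesis using implementable_instr[of Nop] by simp
qed

text \<open>A \<open>Nop\<close> edge joins the end of a copy of the first graph to the start of a
  copy of the second.\<close>

lemma implementable_seq:
  assumes "implementable R" "implementable S"
  shows "implementable (R OO S)"
proof -
  obtain E s t where E: "finite E" "\<And>v v'. (gstep E)\<^sup>*\<^sup>* (s, v) (t, v') \<longleftrightarrow> R v v'"
    using assms(1) unfolding implementable_def by blast
  obtain F a b where F: "finite F" "\<And>v v'. (gstep F)\<^sup>*\<^sup>* (a, v) (b, v') \<longleftrightarrow> S v v'"
    using assms(2) unfolding implementable_def by blast
  let ?G = "insert (0 # t, Nop, 1 # a) (shift 0 E \<union> shift 1 F)"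
  \<comment> \<open>No edge leads back from the second copy, so a reachable configuration either
    still belongs to the first graph or has left it with a store \<open>u\<close> such that
    \<open>R v u\<close>.\<close>
  have inv: "(\<exists>p. fst c = 0 # p \<and> (gstep E)\<^sup>*\<^sup>* (s, v) (p, snd c)) \<or>
      (\<exists>p u. fst c = 1 # p \<and> R v u \<and> (gstep F)\<^sup>*\<^sup>* (a, u) (p, snd c))"
    if "(gstep ?G)\<^sup>*\<^sup>* (0 # s, v) c" for v c
    using that
  proof (induction rule: rtranclp_induct)
    case (step y z)
    from step.hyps(2) step.IH show ?case
      by (cases rule: gstep.cases)
        (auto simp: E(2) dest: gsteps_step rtranclp.rtrancl_into_rtrancl[of R])
  qed simp
  have "(gstep ?G)\<^sup>*\<^sup>* (0 # s, v) (1 # b, v') \<longleftrightarrow> (R OO S) v v'" for v v'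
  proof
    assume "(R OO S) v v'"
    then obtain u where "R v u" "S u v'" by blast
    then have "(gstep ?G)\<^sup>*\<^sup>* (0 # s, v) (0 # t, u)" "(gstep ?G)\<^sup>*\<^sup>* (1 # a, u) (1 # b, v')"
      using E(2) F(2) by (auto intro!: gsteps_shift_pair)
    moreover have "gstep ?G (0 # t, u) (1 # a, u)" by (auto intro: gstepI)
    ultimately show "(gstep ?G)\<^sup>*\<^sup>* (0 # s, v) (1 # b, v')" by auto
  qed (use inv F(2) in fastforce)
  then show ?thesis unfolding implementable_def using E(1) F(1)
    by (intro exI[of _ ?G] exI[of _ "0 # s"] exI[of _ "1 # b"]) simp
qed

text \<open>The empty list is a hub outside the copy, both start and end. \<open>Nop\<close> edges
  lead from it into the copy and back, so that any number of rounds is possible, including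
  none.\<close>

lemma implementable_star:
  assumes "implementable R"
  shows "implementable R\<^sup>*\<^sup>*"
proof -
  obtain E s t where E: "finite E" "\<And>v v'. (gstep E)\<^sup>*\<^sup>* (s, v) (t, v') \<longleftrightarrow> R v v'"
    using assms(1) unfolding implementable_def by blast
  let ?G = "{([], Nop, 0 # s), (0 # t, Nop, [])} \<union> shift 0 E"
  have inv: "(fst c = [] \<and> R\<^sup>*\<^sup>* v (snd c)) \<or>
      (\<exists>p u. fst c = 0 # p \<and> R\<^sup>*\<^sup>* v u \<and> (gstep E)\<^sup>*\<^sup>* (s, u) (p, snd c))"
    if "(gstep ?G)\<^sup>*\<^sup>* ([], v) c" for v c
    using that
  proof (induction rule: rtranclp_induct)
    case (step y z)
    from step.hyps(2) step.IH show ?case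
      by (cases rule: gstep.cases)
        (auto simp: E(2) dest: gsteps_step rtranclp.rtrancl_into_rtrancl[of R])
  qed simp
  have "(gstep ?G)\<^sup>*\<^sup>* ([], v) ([], v') \<longleftrightarrow> R\<^sup>*\<^sup>* v v'" for v v'
  proof
    assume "R\<^sup>*\<^sup>* v v'"
    then show "(gstep ?G)\<^sup>*\<^sup>* ([], v) ([], v')"
    proof (induction rule: rtranclp_induct)
      case (step y z)
      have "gstep ?G ([], y) (0 # s, y)" "gstep ?G (0 # t, z) ([], z)" by (auto intro: gstepI)
      moreover have "(gstep ?G)\<^sup>*\<^sup>* (0 # s, y) (0 # t, z)"
        using step.hyps(2) E(2) by (auto intro!: gsteps_shift_pair)
      ultimately show ?case using step.IH by (meson rtranclp.rtrancl_into_rtrancl rtranclp_trans)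
    qed simp
  qed (use inv in fastforce)
  then show ?thesis unfolding implementable_def using E(1)
    by (intro exI[of _ ?G] exI[of _ "[]"]) simp
qed

text \<open>The fresh start node puts one \<open>Nop\<close> edge before the first proper
  instruction. The automaton uses this edge to choose the counter to be checked, and
  \<open>s \<noteq> t\<close> forces every accepted word to contain an edge.\<close>

lemma implementable_normal_form:
  assumes "implementable R"
  obtains E s t where "finite E" "s \<noteq> t" "\<And>i q. (s, i, q) \<in> E \<Longrightarrow> i = Nop"
    "\<And>v v'. (gstep E)\<^sup>*\<^sup>* (s, v) (t, v') \<longleftrightarrow> R v v'"
proof -
  obtain E s t where E: "finite E" "\<And>v v'. (gstep E)\<^sup>*\<^sup>* (s, v) (t, v') \<longleftrightarrow> R v v'"
    using assms(1) unfolding implementable_def by blast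
  let ?G = "insert ([], Nop, 0 # s) (shift 0 E)"
  have inv: "c = ([], v) \<or> (\<exists>p. fst c = 0 # p \<and> (gstep E)\<^sup>*\<^sup>* (s, v) (p, snd c))"
    if "(gstep ?G)\<^sup>*\<^sup>* ([], v) c" for v c
    using that
  proof (induction rule: rtranclp_induct)
    case (step y z)
    from step.hyps(2) step.IH show ?case
      by (cases rule: gstep.cases)
        (auto simp: E(2) dest: gsteps_step rtranclp.rtrancl_into_rtrancl[of R])
  qed simp
  have "(gstep ?G)\<^sup>*\<^sup>* ([], v) (0 # t, v') \<longleftrightarrow> R v v'" for v v'
  proof
    assume "R v v'"
    then have "(gstep ?G)\<^sup>*\<^sup>* (0 # s, v) (0 # t, v')"
      using E(2) by (auto intro!: gsteps_shift_pair)
    moreover have "gstep ?G ([], v) (0 # s, v)" by (auto intro: gstepI)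
    ultimately show "(gstep ?G)\<^sup>*\<^sup>* ([], v) (0 # t, v')" by auto
  qed (use inv E(2) in fastforce)
  then show ?thesis using E(1) by (intro that[of ?G "[]" "0 # t"]) auto
qed

section \<open>Implementing recursive functions\<close>

text \<open>The star may be left after any round, but the final zero test only lets those executions
  pass on which \<open>k\<close> has been exhausted.\<close>

definition loop :: "nat \<Rightarrow> (store \<Rightarrow> store \<Rightarrow> bool) \<Rightarrow> store \<Rightarrow> store \<Rightarrow> bool" where
  "loop k R = (exec (Dec k) OO R)\<^sup>*\<^sup>* OO exec (Zer k)"

lemma implementable_loop: "implementable R \<Longrightarrow> implementable (loop k R)"
  unfolding loop_def by (intro implementable_seq implementable_star implementable_instr)

text \<open>A zero test followed by a decrement of the same counter always blocks.\<close>

lemma implementable_False: "implementable (\<lambda>v v'. False)"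
proof -
  have "exec (Zer 0) OO exec (Dec 0) = (\<lambda>v v'. False)" by (auto simp: fun_eq_iff)
  then show ?thesis using implementable_seq[OF implementable_instr implementable_instr] by metis
qed

text \<open>\<open>X j\<close> collects the possible stores after \<open>j\<close> rounds; it is a
  set because the body may be undefined or have several results. As \<open>k\<close> holds
  \<open>n - j\<close> there, the zero test can only succeed after exactly \<open>n\<close>
  rounds.\<close>

lemma loop_iff:
  assumes X0: "X 0 = {v}"
    and k: "\<And>j u. j \<le> n \<Longrightarrow> u \<in> X j \<Longrightarrow> u k = n - j"
    and step: "\<And>j u'. j < n \<Longrightarrow> (\<exists>u\<in>X j. R (u(k := n - Suc j)) u') \<longleftrightarrow> u' \<in> X (Suc j)"
  shows "loop k R v v' \<longleftrightarrow> v' \<in> X n"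
proof
  assume "loop k R v v'"
  then have star: "(exec (Dec k) OO R)\<^sup>*\<^sup>* v v'" and z: "v' k = 0" by (auto simp: loop_def)
  from star have "\<exists>j\<le>n. v' \<in> X j"
  proof (induction rule: rtranclp_induct)
    case (step y z)
    then obtain j where j: "j \<le> n" "y \<in> X j" by blast
    from step.hyps(2) have y: "y k > 0" "R (y(k := y k - 1)) z" by auto
    with j k have "j < n" "y k - 1 = n - Suc j" by fastforce+
    with y j assms(3)[of j z] have "z \<in> X (Suc j)" by metis
    with \<open>j < n\<close> show ?case by (auto intro!: exI[of _ "Suc j"])
  qed (use X0 in auto)
  then show "v' \<in> X n" using z k by fastforce
next
  have "(exec (Dec k) OO R)\<^sup>*\<^sup>* v u" if "u \<in> X j" "j \<le> n" for j u
    using that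
  proof (induction j arbitrary: u)
    case (Suc j)
    then obtain y where y: "y \<in> X j" "R (y(k := n - Suc j)) u" using step[of j u] by auto
    then have "(exec (Dec k) OO R) y u" using k[of j y] Suc.prems by (auto intro!: relcomppI)
    with y Suc show ?case by (meson Suc_leD rtranclp.rtrancl_into_rtrancl)
  qed (use X0 in auto)
  moreover assume "v' \<in> X n"
  ultimately have "(exec (Dec k) OO R)\<^sup>*\<^sup>* v v'" "exec (Zer k) v' v'" using k[of n v'] by auto
  then show "loop k R v v'" unfolding loop_def relcompp_apply by blast
qed

lemma loop_iff_fun:
  assumes "S 0 = v" "\<And>j. j \<le> n \<Longrightarrow> S j k = n - j"
    "\<And>j u'. j < n \<Longrightarrow> R ((S j)(k := n - Suc j)) u' \<longleftrightarrow> u' = S (Suc j)"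
  shows "loop k R v v' \<longleftrightarrow> v' = S n"
  using loop_iff[of "\<lambda>j. {S j}" v n k R v'] assms by auto

text \<open>Serves for sequences of partial functions: \<open>z\<close> is the value computed by the
  first program and \<open>f z\<close> the store that contains it.\<close>

lemma relcompp_bind:
  assumes "\<And>u. R v u \<longleftrightarrow> (\<exists>z. P z \<and> u = f z)" "\<And>z. P z \<Longrightarrow> S (f z) v' \<longleftrightarrow> Q z"
  shows "(R OO S) v v' \<longleftrightarrow> (\<exists>z. P z \<and> Q z)"
  using assms by (auto simp: relcompp_apply)

section \<open>Basic register programs\<close>

definition clear :: "nat \<Rightarrow> store \<Rightarrow> store \<Rightarrow> bool" where
  "clear k = loop k (exec Nop)"

definition move :: "nat \<Rightarrow> nat \<Rightarrow> store \<Rightarrow> store \<Rightarrow> bool" where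
  "move a r = loop a (exec (Inc r))"

text \<open>Reading \<open>a\<close> empties it, so its value is sent both to \<open>r\<close> and
  to the scratch register \<open>t\<close>, from which \<open>a\<close> is then restored.\<close>

definition copy :: "nat \<Rightarrow> nat \<Rightarrow> nat \<Rightarrow> store \<Rightarrow> store \<Rightarrow> bool" where
  "copy a r t = loop a (exec (Inc r) OO exec (Inc t)) OO move t a"

lemma implementable_clear: "implementable (clear k)"
  and implementable_move: "implementable (move a r)"
  and implementable_copy: "implementable (copy a r t)"
  unfolding clear_def move_def copy_def
  by (intro implementable_seq implementable_loop implementable_instr)+

lemma clear_iff: "clear k v v' \<longleftrightarrow> v' = v(k := 0)"
  unfolding clear_def by (subst loop_iff_fun[of "\<lambda>j. v(k := v k - j)" _ "v k"]) auto

lemma move_iff: "a \<noteq> r \<Longrightarrow> move a r v v' \<longleftrightarrow> v' = v(a := 0, r := v r + v a)"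
  unfolding move_def
  by (subst loop_iff_fun[of "\<lambda>j. v(a := v a - j, r := v r + j)" _ "v a"])
    (auto simp: fun_eq_iff)

lemma copy_iff:
  assumes "distinct [a, r, t]" "v t = 0"
  shows "copy a r t v v' \<longleftrightarrow> v' = v(r := v r + v a)"
proof -
  have "loop a (exec (Inc r) OO exec (Inc t)) v u \<longleftrightarrow> u = v(a := 0, r := v r + v a, t := v a)" for u
  proof -
    have "exec (Inc r) OO exec (Inc t) = (\<lambda>v v'. v' = v(r := Suc (v r), t := Suc (v t)))"
      by (intro ext) (use assms(1) in \<open>simp add: relcompp_apply\<close>)
    then show ?thesis
      using assms
      by (subst loop_iff_fun[of "\<lambda>j. v(a := v a - j, r := v r + j, t := j)" _ "v a"])
        (auto simp: fun_eq_iff)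
  qed
  then have "copy a r t v v' \<longleftrightarrow> move t a (v(a := 0, r := v r + v a, t := v a)) v'"
    by (simp add: copy_def relcompp_apply)
  also have "\<dots> \<longleftrightarrow> v' = v(r := v r + v a)"
  proof -
    have "v(a := 0, r := v r + v a, t := v a, t := 0, a := 0 + v a) = v(r := v r + v a)"
      using assms by (auto simp: fun_eq_iff)
    then show ?thesis using assms(1) by (simp add: move_iff)
  qed
  finally show ?thesis .
qed

text \<open>The registers from \<open>b\<close> on serve as scratch space, which is restored to zero.\<close>

definition computes :: "recf \<Rightarrow> nat list \<Rightarrow> nat \<Rightarrow> nat \<Rightarrow> (store \<Rightarrow> store \<Rightarrow> bool) \<Rightarrow> bool" where
  "computes f as r b R \<longleftrightarrow> implementable R \<and>
     (\<forall>v v'. (\<forall>k\<ge>b. v k = 0) \<longrightarrow> v r = 0 \<longrightarrow>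
        (R v v' \<longleftrightarrow> (\<exists>y. rec_eval f (map v as) y \<and> v' = v(r := y))))"

definition allocatable :: "nat list \<Rightarrow> nat \<Rightarrow> nat \<Rightarrow> bool" where
  "allocatable as r b \<longleftrightarrow> r < b \<and> r \<notin> set as \<and> (\<forall>a\<in>set as. a < b)"

text \<open>Quantifying over all register layouts allows a subprogram to be placed wherever the
  surrounding program has room.\<close>

definition compilable :: "recf \<Rightarrow> bool" where
  "compilable f \<longleftrightarrow> (\<forall>as r b. allocatable as r b \<longrightarrow> (\<exists>R. computes f as r b R))"

lemma compilableE:
  assumes "allocatable as r b" "compilable f"
  obtains R where "computes f as r b R"
proof -
  from assms have "\<exists>R. computes f as r b R" unfolding compilable_def by simp
  then show thesis using that by (elim exE)
qed

lemma computes_iff: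
  assumes "computes f as r b R" "\<forall>k\<ge>b. v k = 0" "v r = 0"
  shows "R v v' \<longleftrightarrow> (\<exists>y. rec_eval f (map v as) y \<and> v' = v(r := y))"
  using assms by (simp add: computes_def)

lemma computes_implementable: "computes f as r b R \<Longrightarrow> implementable R"
  by (simp add: computes_def)

lemma rec_eval_Zero_iff: "rec_eval Zero xs y \<longleftrightarrow> y = 0"
  by (auto intro: rec_eval.intros elim: rec_eval_elims)

lemma rec_eval_Succ_iff: "rec_eval Succ xs y \<longleftrightarrow> (\<exists>x. xs = [x] \<and> y = Suc x)"
  by (auto intro: rec_eval.intros elim: rec_eval_elims)

lemma rec_eval_Proj_iff: "rec_eval (Proj i) xs y \<longleftrightarrow> i < length xs \<and> y = xs ! i"
  by (auto intro: rec_eval.intros elim: rec_eval_elims)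

lemma rec_eval_Comp_iff:
  "rec_eval (Comp f gs) xs z \<longleftrightarrow> (\<exists>ys. list_all2 (\<lambda>g y. rec_eval g xs y) gs ys \<and> rec_eval f ys z)"
  by (auto intro: rec_eval.intros elim!: rec_eval_elims(4))

lemma rec_eval_PrimRec_Nil: "\<not> rec_eval (PrimRec f g) [] y"
  by (auto elim: rec_eval.cases)

lemma rec_eval_PrimRec_0_iff: "rec_eval (PrimRec f g) (0 # xs) y \<longleftrightarrow> rec_eval f xs y"
  by (auto intro: rec_eval.intros elim: rec_eval_elims(5))

lemma rec_eval_PrimRec_Suc_iff:
  "rec_eval (PrimRec f g) (Suc n # xs) z \<longleftrightarrow>
     (\<exists>y. rec_eval (PrimRec f g) (n # xs) y \<and> rec_eval g (n # y # xs) z)"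
  by (auto intro: rec_eval.intros elim: rec_eval_elims(6))

lemma rec_eval_Mu_iff:
  "rec_eval (Mu f) xs n \<longleftrightarrow> rec_eval f (n # xs) 0 \<and> (\<forall>m<n. \<exists>y>0. rec_eval f (m # xs) y)"
  by (auto intro: rec_eval.intros elim: rec_eval_elims(7))

section \<open>Compilation of the constructors of recursive functions\<close>

lemma compilable_Zero: "compilable Zero"
  unfolding compilable_def
proof (intro allI impI exI)
  fix as r b
  \<comment> \<open>The result register already holds 0.\<close>
  show "computes Zero as r b (exec Nop)"
    by (auto simp: computes_def rec_eval_Zero_iff implementable_instr fun_upd_idem)
qed

lemma compilable_Proj: "compilable (Proj i)"
  unfolding compilable_def
proof (intro allI impI)
  fix as r b assume "allocatable as r b"
  then have *: "r < b" "r \<notin> set as" "\<forall>a\<in>set as. a < b" by (auto simp: allocatable_def)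
  show "\<exists>R. computes (Proj i) as r b R"
  proof (cases "i < length as")
    case True
    then have "as ! i < b" "as ! i \<noteq> r" using * by auto
    then have "computes (Proj i) as r b (copy (as ! i) r b)"
      using True *(1) by (auto simp: computes_def rec_eval_Proj_iff implementable_copy copy_iff)
    then show ?thesis by blast
  next
    case False
    \<comment> \<open>A projection beyond the arguments is undefined, which is rendered by a graph
      that never reaches its end.\<close>
    then have "computes (Proj i) as r b (\<lambda>_ _. False)"
      by (auto simp: computes_def rec_eval_Proj_iff implementable_False)
    then show ?thesis by blast
  qed
qed

lemma compilable_Succ: "compilable Succ"
  unfolding compilable_def
proof (intro allI impI)
  fix as r b assume "allocatable as r b"
  then have *: "r < b" "r \<notin> set as" "\<forall>a\<in>set as. a < b" by (auto simp: allocatable_def)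
  show "\<exists>R. computes Succ as r b R"
  proof (cases "\<exists>a. as = [a]")
    case True
    then obtain a where a: "as = [a]" by blast
    then have "computes Succ as r b (copy a r b OO exec (Inc r))"
      using *
      by (auto simp: computes_def rec_eval_Succ_iff implementable_copy implementable_seq
          implementable_instr copy_iff relcompp_apply)
    then show ?thesis by blast
  next
    case False
    then have "computes Succ as r b (\<lambda>_ _. False)"
      by (auto simp: computes_def rec_eval_Succ_iff implementable_False)
    then show ?thesis by blast
  qed
qed

definition put :: "nat \<Rightarrow> nat list \<Rightarrow> store \<Rightarrow> store" where
  "put b ys v = (\<lambda>k. if b \<le> k \<and> k < b + length ys then ys ! (k - b) else v k)"

lemma put_Nil [simp]: "put b [] v = v"
  by (auto simp: put_def)

lemma put_Cons: "put b (y # ys) v = put (Suc b) ys (v(b := y))"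
  by (auto simp: put_def fun_eq_iff nth_Cons' Suc_diff_Suc)

lemma map_put: "map (put b ys v) [b..<b + length ys] = ys"
  by (intro nth_equalityI) (auto simp: put_def)

text \<open>The values are stored consecutively from \<open>b\<close> on, each evaluation using the
  registers above its result as scratch space. The arguments lie below \<open>b\<close> and hence
  stay intact for the later functions.\<close>

lemma implementable_args:
  assumes "\<forall>g\<in>set gs. compilable g" "\<forall>a\<in>set as. a < b"
  shows "\<exists>R. implementable R \<and> (\<forall>v v'. (\<forall>k\<ge>b. v k = 0) \<longrightarrow>
           (R v v' \<longleftrightarrow> (\<exists>ys. list_all2 (\<lambda>g y. rec_eval g (map v as) y) gs ys \<and> v' = put b ys v)))"
  using assms
proof (induction gs arbitrary: b)
  case Nil
  show ?case using implementable_skip by auto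
next
  case (Cons g gs)
  then have "\<forall>a\<in>set as. a < Suc b" by auto
  with Cons obtain R where R: "implementable R" "\<And>v v'. (\<forall>k\<ge>Suc b. v k = 0) \<Longrightarrow>
           (R v v' \<longleftrightarrow> (\<exists>ys. list_all2 (\<lambda>g y. rec_eval g (map v as) y) gs ys \<and> v' = put (Suc b) ys v))"
    by (metis list.set_intros(2))
  have "allocatable as b (Suc b)" using Cons.prems by (auto simp: allocatable_def)
  with Cons.prems obtain S where S: "computes g as b (Suc b) S"
    by (meson compilableE list.set_intros(1))
  have "(S OO R) v v' \<longleftrightarrow> (\<exists>ys. list_all2 (\<lambda>g y. rec_eval g (map v as) y) (g # gs) ys \<and> v' = put b ys v)"
    if v: "\<forall>k\<ge>b. v k = 0" for v v'
  proof -
    have m: "map (v(b := y)) as = map v as" for y using Cons.prems by auto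
    have "(S OO R) v v' \<longleftrightarrow> (\<exists>y. rec_eval g (map v as) y \<and> R (v(b := y)) v')"
      using computes_iff[OF S] v by (auto simp: relcompp_apply)
    also have "\<dots> \<longleftrightarrow> (\<exists>y ys. rec_eval g (map v as) y \<and>
        list_all2 (\<lambda>g y. rec_eval g (map v as) y) gs ys \<and> v' = put b (y # ys) v)"
      using R(2) v by (auto simp: m put_Cons)
    finally show ?thesis by (auto simp: list_all2_Cons1)
  qed
  then show ?case
    using implementable_seq[OF computes_implementable[OF S] R(1)] by blast
qed

lemma implementable_clear_range:
  "\<exists>R. implementable R \<and> (\<forall>v v'. R v v' \<longleftrightarrow> v' = (\<lambda>k. if b \<le> k \<and> k < b + n then 0 else v k))"
proof (induction n)
  case 0
  have "(\<lambda>k. if b \<le> k \<and> k < b + 0 then 0 else v k) = v" for v :: store by (auto simp: fun_eq_iff)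
  then show ?case using implementable_skip by auto
next
  case (Suc n)
  then obtain R where R: "implementable R"
    "\<And>v v'. R v v' \<longleftrightarrow> v' = (\<lambda>k. if b \<le> k \<and> k < b + n then 0 else v k)" by blast
  have "(R OO clear (b + n)) v v' \<longleftrightarrow> v' = (\<lambda>k. if b \<le> k \<and> k < b + Suc n then 0 else v k)" for v v'
  proof -
    have "(\<lambda>k. if b \<le> k \<and> k < b + n then 0 else v k)(b + n := 0) =
        (\<lambda>k. if b \<le> k \<and> k < b + Suc n then 0 else v k)"
      by (auto simp: fun_eq_iff less_Suc_eq)
    then show ?thesis by (simp add: relcompp_apply R(2) clear_iff)
  qed
  then show ?case using implementable_seq[OF R(1) implementable_clear] by blast
qed

lemma compilable_Comp:
  assumes "compilable f" "\<forall>g\<in>set gs. compilable g"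
  shows "compilable (Comp f gs)"
  unfolding compilable_def
proof (intro allI impI)
  fix as r b assume "allocatable as r b"
  then have *: "r < b" "r \<notin> set as" "\<forall>a\<in>set as. a < b" by (auto simp: allocatable_def)
  let ?m = "length gs"
  obtain R where R: "implementable R" "\<And>v v'. (\<forall>k\<ge>b. v k = 0) \<Longrightarrow>
        (R v v' \<longleftrightarrow> (\<exists>ys. list_all2 (\<lambda>g y. rec_eval g (map v as) y) gs ys \<and> v' = put b ys v))"
    using implementable_args[OF assms(2) *(3)] by metis
  have "allocatable [b..<b + ?m] r (b + ?m)" using * by (auto simp: allocatable_def)
  then obtain S where S: "computes f [b..<b + ?m] r (b + ?m) S"
    using assms(1) by (rule compilableE)
  obtain C where C: "implementable C"
    "\<And>v v'. C v v' \<longleftrightarrow> v' = (\<lambda>k. if b \<le> k \<and> k < b + ?m then 0 else v k)"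
    using implementable_clear_range by metis
  have "(R OO S OO C) v v' \<longleftrightarrow> (\<exists>y. rec_eval (Comp f gs) (map v as) y \<and> v' = v(r := y))"
    if v: "\<forall>k\<ge>b. v k = 0" "v r = 0" for v v'
  proof -
    have S': "(S OO C) (put b ys v) v' \<longleftrightarrow> (\<exists>z. rec_eval f ys z \<and> v' = v(r := z))"
      if "length ys = ?m" for ys
    proof -
      have "S (put b ys v) u \<longleftrightarrow> (\<exists>z. rec_eval f ys z \<and> u = (put b ys v)(r := z))" for u
        using computes_iff[OF S, of "put b ys v" u] v * that map_put[of b ys v]
        by (simp add: put_def)
      moreover have "C ((put b ys v)(r := z)) v' \<longleftrightarrow> v' = v(r := z)" for z
        using * v that by (auto simp: C(2) put_def fun_eq_iff)
      ultimately show ?thesis by (auto simp: relcompp_apply)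
    qed
    have "(R OO S OO C) v v' \<longleftrightarrow> (\<exists>ys. list_all2 (\<lambda>g y. rec_eval g (map v as) y) gs ys \<and>
        (S OO C) (put b ys v) v')"
      using R(2)[OF v(1)] by (auto simp: relcompp_apply)
    also have "\<dots> \<longleftrightarrow> (\<exists>ys z. list_all2 (\<lambda>g y. rec_eval g (map v as) y) gs ys \<and>
        rec_eval f ys z \<and> v' = v(r := z))"
      using S' by (metis list_all2_lengthD)
    finally show ?thesis by (auto simp: rec_eval_Comp_iff)
  qed
  then have "computes (Comp f gs) as r b (R OO S OO C)"
    using R(1) C(1) computes_implementable[OF S] by (auto simp: computes_def intro!: implementable_seq)
  then show "\<exists>R. computes (Comp f gs) as r b R" by blast
qed

lemma compilable_PrimRec:
  assumes "compilable f" "compilable g"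
  shows "compilable (PrimRec f g)"
  unfolding compilable_def
proof (intro allI impI)
  fix as r b assume al: "allocatable as r b"
  show "\<exists>R. computes (PrimRec f g) as r b R"
  proof (cases as)
    case Nil
    then have "computes (PrimRec f g) as r b (\<lambda>_ _. False)"
      by (auto simp: computes_def rec_eval_PrimRec_Nil implementable_False)
    then show ?thesis by blast
  next
    case (Cons a xs)
    \<comment> \<open>\<open>i\<close> counts the completed rounds and \<open>m\<close> the
      remaining ones; \<open>acc\<close> holds the current value of the recursion and
      \<open>t\<close> receives the next one. Scratch space for the subprograms starts at
      \<open>c\<close>.\<close>
    define i m acc t c where "i = b" "m = Suc b" "acc = Suc (Suc b)" "t = Suc (Suc (Suc b))"
      "c = Suc (Suc (Suc (Suc b)))"
    note regs = this
    from al Cons have *: "r < b" "a < b" "r \<noteq> a" "r \<notin> set xs" "\<forall>x\<in>set xs. x < b"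
      by (auto simp: allocatable_def)
    have "allocatable xs acc c" using * by (auto simp: allocatable_def regs)
    then obtain F where F: "computes f xs acc c F" using assms(1) by (rule compilableE)
    have "allocatable (i # acc # xs) t c" using * by (auto simp: allocatable_def regs)
    then obtain G where G: "computes g (i # acc # xs) t c G" using assms(2) by (rule compilableE)
    define B where "B = G OO clear acc OO move t acc OO exec (Inc i)"
    define R where "R = F OO copy a m c OO loop m B OO move acc r OO clear i"
    have impl: "implementable R"
      unfolding R_def B_def using F G
      by (intro implementable_seq implementable_loop implementable_instr implementable_clear
          implementable_move implementable_copy) (auto simp: computes_def)
    have "R v v' \<longleftrightarrow> (\<exists>y. rec_eval (PrimRec f g) (map v as) y \<and> v' = v(r := y))"
      if v: "\<forall>k\<ge>b. v k = 0" "v r = 0" for v v'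
    proof -
      let ?ev = "\<lambda>j y. rec_eval (PrimRec f g) (j # map v xs) y"
      define n where "n = v a"
      have Fv: "F v u \<longleftrightarrow> (\<exists>y. ?ev 0 y \<and> u = v(acc := y))" for u
        using computes_iff[OF F, of v u] v by (simp add: regs rec_eval_PrimRec_0_iff)
      define st where "st j y = v(i := j, m := n - j, acc := y)" for j y
      have cp: "copy a m c (v(acc := y)) u \<longleftrightarrow> u = st 0 y" for y u
        using * v by (subst copy_iff) (auto simp: st_def regs n_def fun_eq_iff)
      have body: "B ((st j y)(m := n - Suc j)) u \<longleftrightarrow>
          (\<exists>z. rec_eval g (j # y # map v xs) z \<and> u = st (Suc j) z)" if "j < n" for j y u
      proof -
        define s where "s = (st j y)(m := n - Suc j)"
        have mp: "map s (i # acc # xs) = j # y # map v xs"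
          using * by (auto simp: s_def st_def regs)
        have "G s u \<longleftrightarrow> (\<exists>z. rec_eval g (j # y # map v xs) z \<and> u = s(t := z))" for u
          using computes_iff[OF G, of s u] v unfolding mp by (simp add: s_def st_def regs)
        moreover have "(clear acc OO move t acc OO exec (Inc i)) (s(t := z)) u \<longleftrightarrow> u = st (Suc j) z" for z u
        proof -
          have "(clear acc OO move t acc OO exec (Inc i)) (s(t := z)) u \<longleftrightarrow>
            u = (let w = s(t := z, acc := 0); w = w(t := 0, acc := z) in w(i := Suc (w i)))"
            by (auto simp: relcompp_apply clear_iff move_iff regs)
          also have "\<dots> \<longleftrightarrow> u = st (Suc j) z"
          proof -
            have "(let w = s(t := z, acc := 0); w = w(t := 0, acc := z) in w(i := Suc (w i))) = st (Suc j) z"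
              using v(1) by (auto simp: s_def st_def regs fun_eq_iff)
            then show ?thesis by simp
          qed
          finally show ?thesis .
        qed
        ultimately show ?thesis unfolding s_def[symmetric] B_def
          by (intro relcompp_bind[where f = "\<lambda>z. s(t := z)"])
      qed
      have lp: "loop m B (st 0 y0) u \<longleftrightarrow> (\<exists>y. ?ev n y \<and> u = st n y)" if y0: "?ev 0 y0" for y0 u
      proof -
        \<comment> \<open>\<open>?X 0\<close> is a singleton because \<open>rec_eval\<close> is
          deterministic. If \<open>g\<close> is undefined in some round, all later sets are empty,
          and the loop blocks.\<close>
        let ?X = "\<lambda>j. {st j y |y. ?ev j y}"
        have "loop m B (st 0 y0) u \<longleftrightarrow> u \<in> ?X n"
        proof (rule loop_iff)
          show "?X 0 = {st 0 y0}" using y0 rec_eval_deterministic by auto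
          show "u m = n - j" if "u \<in> ?X j" for j u using that by (auto simp: st_def regs)
          show "(\<exists>u\<in>?X j. B (u(m := n - Suc j)) u') \<longleftrightarrow> u' \<in> ?X (Suc j)" if "j < n" for j u'
          proof -
            have "(\<exists>u\<in>?X j. B (u(m := n - Suc j)) u') \<longleftrightarrow>
              (\<exists>y. ?ev j y \<and> B ((st j y)(m := n - Suc j)) u')" by blast
            then show ?thesis using body[OF that] by (auto simp: rec_eval_PrimRec_Suc_iff)
          qed
        qed
        then show ?thesis by auto
      qed
      have fin: "(move acc r OO clear i) (st n y) u \<longleftrightarrow> u = v(r := y)" for y u
      proof -
        have "(move acc r OO clear i) (st n y) u \<longleftrightarrow> u = ((st n y)(acc := 0, r := y))(i := 0)"
          using * v by (auto simp: relcompp_apply clear_iff move_iff regs st_def)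
        moreover have "((st n y)(acc := 0, r := y))(i := 0) = v(r := y)"
          using * v by (auto simp: st_def regs fun_eq_iff)
        ultimately show ?thesis by simp
      qed
      have FC: "(F OO copy a m c) v u \<longleftrightarrow> (\<exists>y. ?ev 0 y \<and> u = st 0 y)" for u
        by (rule relcompp_bind[where P = "?ev 0" and f = "\<lambda>y. v(acc := y)" and Q = "\<lambda>y. u = st 0 y"])
          (simp_all only: Fv cp)
      have LM: "(loop m B OO (move acc r OO clear i)) (st 0 y0) v' \<longleftrightarrow>
          (\<exists>y. ?ev n y \<and> v' = v(r := y))" if "?ev 0 y0" for y0
        by (rule relcompp_bind[where P = "?ev n" and f = "st n" and Q = "\<lambda>y. v' = v(r := y)"])
          (simp_all only: lp[OF that] fin)
      have "((F OO copy a m c) OO (loop m B OO (move acc r OO clear i))) v v' \<longleftrightarrow>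
          (\<exists>y0. ?ev 0 y0 \<and> (\<exists>y. ?ev n y \<and> v' = v(r := y)))"
        by (rule relcompp_bind[where P = "?ev 0" and f = "st 0" and Q = "\<lambda>_. \<exists>y. ?ev n y \<and> v' = v(r := y)"])
          (simp_all only: FC LM)
      then have "R v v' \<longleftrightarrow> (\<exists>y0. ?ev 0 y0 \<and> (\<exists>y. ?ev n y \<and> v' = v(r := y)))"
        by (simp add: R_def relcompp_assoc)
      also have "\<dots> \<longleftrightarrow> (\<exists>y. ?ev n y \<and> v' = v(r := y))"
      proof -
        \<comment> \<open>A value at any \<open>j\<close> presupposes one at 0, so the condition on
          \<open>y0\<close> is absorbed by the other one.\<close>
        have "\<exists>y0. ?ev 0 y0" if "?ev j y" for j y
          using that by (induction j arbitrary: y) (auto simp: rec_eval_PrimRec_Suc_iff)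
        then show ?thesis by blast
      qed
      finally show ?thesis by (simp add: Cons n_def)
    qed
    then have "computes (PrimRec f g) as r b R" using impl by (auto simp: computes_def)
    then show ?thesis by blast
  qed
qed

lemma compilable_Mu:
  assumes "compilable f"
  shows "compilable (Mu f)"
  unfolding compilable_def
proof (intro allI impI)
  fix as r b assume "allocatable as r b"
  then have *: "r < b" "r \<notin> set as" "\<forall>a\<in>set as. a < b" by (auto simp: allocatable_def)
  define i t c where "i = b" "t = Suc b" "c = Suc (Suc b)"
  note regs = this
  have "allocatable (i # as) t c" using * by (auto simp: allocatable_def regs)
  then obtain F where F: "computes f (i # as) t c F" using assms by (rule compilableE)
  \<comment> \<open>The decrement tests that the value of \<open>f\<close> at \<open>i\<close> is
    positive. The search therefore cannot go past a zero, and the zero test in \<open>R\<close> lets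
    it end only there.\<close>
  define B where "B = exec (Dec t) OO clear t OO exec (Inc i) OO F"
  define R where "R = F OO B\<^sup>*\<^sup>* OO exec (Zer t) OO move i r"
  have impl: "implementable R"
    unfolding R_def B_def using F
    by (intro implementable_seq implementable_star implementable_instr implementable_clear
        implementable_move) (auto simp: computes_def)
  have "R v v' \<longleftrightarrow> (\<exists>y. rec_eval (Mu f) (map v as) y \<and> v' = v(r := y))"
    if v: "\<forall>k\<ge>b. v k = 0" "v r = 0" for v v'
  proof -
    let ?ev = "\<lambda>j y. rec_eval f (j # map v as) y"
    define st where "st j y = v(i := j, t := y)" for j y
    have Fv: "F (st j 0) u \<longleftrightarrow> (\<exists>y. ?ev j y \<and> u = st j y)" for j u
    proof -
      have mp: "map (st j 0) (i # as) = j # map v as" using * by (auto simp: st_def regs)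
      show ?thesis using computes_iff[OF F, of "st j 0" u] v unfolding mp
        by (simp add: st_def regs)
    qed
    have "v i = 0" "v t = 0" using v(1) by (simp_all add: regs)
    then have v0: "st 0 0 = v" unfolding st_def by (metis fun_upd_triv)
    have step: "B (st j y) u \<longleftrightarrow> y > 0 \<and> (\<exists>z. ?ev (Suc j) z \<and> u = st (Suc j) z)" for j y u
    proof -
      have "(exec (Dec t) OO clear t OO exec (Inc i)) (st j y) w \<longleftrightarrow> y > 0 \<and> w = st (Suc j) 0" for w
      proof -
        have "(exec (Dec t) OO clear t OO exec (Inc i)) s w \<longleftrightarrow>
            s t > 0 \<and> w = (let u = s(t := s t - 1, t := 0) in u(i := Suc (u i)))" for s
          unfolding relcompp_apply by (simp add: clear_iff)
        moreover have "(let u = (st j y)(t := st j y t - 1, t := 0) in u(i := Suc (u i))) = st (Suc j) 0"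
          by (simp add: st_def regs fun_eq_iff)
        moreover have "st j y t = y" by (simp add: st_def)
        ultimately show ?thesis by simp
      qed
      then have "((exec (Dec t) OO clear t OO exec (Inc i)) OO F) (st j y) u \<longleftrightarrow>
          y > 0 \<and> F (st (Suc j) 0) u"
        unfolding relcompp_apply[of _ F] by simp
      then have "B (st j y) u \<longleftrightarrow> y > 0 \<and> F (st (Suc j) 0) u"
        by (simp add: B_def relcompp_assoc)
      then show ?thesis by (simp add: Fv)
    qed
    have sound: "\<exists>j y. u = st j y \<and> ?ev j y \<and> (\<forall>k<j. \<exists>y>0. ?ev k y)"
      if "B\<^sup>*\<^sup>* (st 0 y0) u" "?ev 0 y0" for y0 u
      using that
    proof (induction rule: rtranclp_induct)
      case (step u w)
      then obtain j y where j: "u = st j y" "?ev j y" "\<forall>k<j. \<exists>y>0. ?ev k y" by blast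
      with step.hyps(2) \<open>\<And>j y u. B (st j y) u \<longleftrightarrow> _\<close> obtain z
        where z: "y > 0" "?ev (Suc j) z" "w = st (Suc j) z" by blast
      with j show ?case by (intro exI[of _ "Suc j"] exI[of _ z]) (auto simp: less_Suc_eq)
    qed auto
    have complete: "\<exists>y0. ?ev 0 y0 \<and> B\<^sup>*\<^sup>* (st 0 y0) (st j y)" if "?ev j y" "\<forall>k<j. \<exists>y>0. ?ev k y" for j y
      using that
    proof (induction j arbitrary: y)
      case (Suc j)
      then obtain x where x: "x > 0" "?ev j x" by blast
      with Suc obtain y0 where "?ev 0 y0" "B\<^sup>*\<^sup>* (st 0 y0) (st j x)" by (metis less_Suc_eq)
      moreover have "B (st j x) (st (Suc j) y)" using step x Suc.prems by auto
      ultimately show ?case by (meson rtranclp.rtrancl_into_rtrancl)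
    qed auto
    have mv: "move i r (st j 0) v' \<longleftrightarrow> v' = v(r := j)" for j
    proof -
      have "move i r (st j 0) v' \<longleftrightarrow> v' = (st j 0)(i := 0, r := j)"
        using * v by (subst move_iff) (auto simp: st_def regs)
      moreover have "(st j 0)(i := 0, r := j) = v(r := j)"
        using * v by (auto simp: st_def regs fun_eq_iff)
      ultimately show ?thesis by simp
    qed
    have "R v v' \<longleftrightarrow> (\<exists>y0 u. ?ev 0 y0 \<and> B\<^sup>*\<^sup>* (st 0 y0) u \<and> u t = 0 \<and> move i r u v')"
    proof -
      have "F v u \<longleftrightarrow> (\<exists>y. ?ev 0 y \<and> u = st 0 y)" for u using Fv[of 0 u] unfolding v0 .
      then show ?thesis unfolding R_def by (auto simp: relcompp_apply) 
    qed
    also have "\<dots> \<longleftrightarrow> (\<exists>j. ?ev j 0 \<and> (\<forall>k<j. \<exists>y>0. ?ev k y) \<and> v' = v(r := j))"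
    proof
      assume "\<exists>y0 u. ?ev 0 y0 \<and> B\<^sup>*\<^sup>* (st 0 y0) u \<and> u t = 0 \<and> move i r u v'"
      then obtain y0 u where "?ev 0 y0" "B\<^sup>*\<^sup>* (st 0 y0) u" and u: "u t = 0" "move i r u v'" by blast
      from sound[OF this(2,1)] obtain j y
        where j: "u = st j y" "?ev j y" "\<forall>k<j. \<exists>y>0. ?ev k y" by blast
      then have "y = 0" using u by (simp add: st_def)
      with j u mv show "\<exists>j. ?ev j 0 \<and> (\<forall>k<j. \<exists>y>0. ?ev k y) \<and> v' = v(r := j)" by blast
    next
      assume "\<exists>j. ?ev j 0 \<and> (\<forall>k<j. \<exists>y>0. ?ev k y) \<and> v' = v(r := j)"
      then obtain j where j: "?ev j 0" "\<forall>k<j. \<exists>y>0. ?ev k y" "v' = v(r := j)" by blast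
      moreover have "st j 0 t = 0" by (simp add: st_def)
      ultimately show "\<exists>y0 u. ?ev 0 y0 \<and> B\<^sup>*\<^sup>* (st 0 y0) u \<and> u t = 0 \<and> move i r u v'"
        using complete[OF j(1,2)] mv by metis
    qed
    finally show ?thesis by (auto simp: rec_eval_Mu_iff)
  qed
  then have "computes (Mu f) as r b R" using impl by (auto simp: computes_def)
  then show "\<exists>R. computes (Mu f) as r b R" by blast
qed

lemma compilable: "compilable f"
  by (induction f)
    (auto intro: compilable_Zero compilable_Succ compilable_Proj compilable_Comp
      compilable_PrimRec compilable_Mu)

section \<open>Recursive functions of the codes\<close>

definition rec1 :: "(nat \<Rightarrow> nat) \<Rightarrow> bool" where
  "rec1 g \<longleftrightarrow> (\<exists>f. \<forall>x. rec_eval f [x] (g x))"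

definition rec2 :: "(nat \<Rightarrow> nat \<Rightarrow> nat) \<Rightarrow> bool" where
  "rec2 g \<longleftrightarrow> (\<exists>f. \<forall>x y. rec_eval f [x, y] (g x y))"

text \<open>Arguments are addressed by position, so that recursiveness of a composite expression
  follows by applying introduction rules along its structure.\<close>

definition recn :: "nat \<Rightarrow> (nat list \<Rightarrow> nat) \<Rightarrow> bool" where
  "recn n g \<longleftrightarrow> (\<exists>f. \<forall>xs. length xs = n \<longrightarrow> rec_eval f xs (g xs))"

lemma recn_nth: "i < n \<Longrightarrow> recn n (\<lambda>xs. xs ! i)"
  unfolding recn_def by (rule exI[of _ "Proj i"]) (auto intro: rec_eval.proj)

lemma recn_comp1: "rec1 g \<Longrightarrow> recn n F \<Longrightarrow> recn n (\<lambda>xs. g (F xs))"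
proof -
  assume "rec1 g" "recn n F"
  then obtain g' f where "\<And>x. rec_eval g' [x] (g x)" "\<And>xs. length xs = n \<Longrightarrow> rec_eval f xs (F xs)"
    by (auto simp: rec1_def recn_def)
  then have "\<forall>xs. length xs = n \<longrightarrow> rec_eval (Comp g' [f]) xs (g (F xs))"
    by (auto intro!: rec_eval.comp[where ys = "[F _]"])
  then show ?thesis by (auto simp: recn_def)
qed

lemma recn_comp2: "rec2 g \<Longrightarrow> recn n F \<Longrightarrow> recn n G \<Longrightarrow> recn n (\<lambda>xs. g (F xs) (G xs))"
proof -
  assume "rec2 g" "recn n F" "recn n G"
  then obtain g' f h where "\<And>x y. rec_eval g' [x, y] (g x y)"
    "\<And>xs. length xs = n \<Longrightarrow> rec_eval f xs (F xs)" "\<And>xs. length xs = n \<Longrightarrow> rec_eval h xs (G xs)"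
    by (auto simp: rec2_def recn_def)
  then have "\<forall>xs. length xs = n \<longrightarrow> rec_eval (Comp g' [f, h]) xs (g (F xs) (G xs))"
    by (auto intro!: rec_eval.comp[where ys = "[F _, G _]"])
  then show ?thesis by (auto simp: recn_def)
qed

lemma rec1_Suc: "rec1 Suc"
  by (auto simp: rec1_def intro: rec_eval.succ)

lemma recn_const: "recn n (\<lambda>_. c)"
proof (induction c)
  case 0
  show ?case by (auto simp: recn_def intro: rec_eval.zero)
next
  case (Suc c)
  then show ?case by (rule recn_comp1[OF rec1_Suc])
qed

lemma rec1_recn: "recn 1 (\<lambda>xs. g (xs ! 0)) \<Longrightarrow> rec1 g"
proof -
  assume "recn 1 (\<lambda>xs. g (xs ! 0))"
  then obtain f where f: "\<And>xs. length xs = 1 \<Longrightarrow> rec_eval f xs (g (xs ! 0))" by (auto simp: recn_def)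
  have "rec_eval f [x] (g x)" for x using f[of "[x]"] by simp
  then show ?thesis by (auto simp: rec1_def)
qed

lemma rec2_recn: "recn 2 (\<lambda>xs. g (xs ! 0) (xs ! 1)) \<Longrightarrow> rec2 g"
proof -
  assume "recn 2 (\<lambda>xs. g (xs ! 0) (xs ! 1))"
  then obtain f where f: "\<And>xs. length xs = 2 \<Longrightarrow> rec_eval f xs (g (xs ! 0) (xs ! 1))"
    by (auto simp: recn_def)
  have "rec_eval f [x, y] (g x y)" for x y using f[of "[x, y]"] by simp
  then show ?thesis by (auto simp: rec2_def)
qed

lemma rec1_primrec:
  assumes "rec2 g" "\<And>n. h (Suc n) = g n (h n)"
  shows "rec1 h"
proof -
  obtain g' where g': "\<And>x y. rec_eval g' [x, y] (g x y)" using assms(1) by (auto simp: rec2_def)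
  \<comment> \<open>The recursion has no parameters besides \<open>n\<close>, so the base case is a
    constant of arity 0.\<close>
  obtain a where a: "rec_eval a [] (h 0)" using recn_const[of 0 "h 0"] by (auto simp: recn_def)
  have "rec_eval (PrimRec a g') [n] (h n)" for n
  proof (induction n)
    case 0
    show ?case using a by (rule rec_eval.prim_0)
  next
    case (Suc n)
    then show ?case using g' assms(2) by (auto intro: rec_eval.prim_Suc)
  qed
  then show ?thesis by (auto simp: rec1_def)
qed

lemma rec2_add: "rec2 (+)"
proof -
  have "rec_eval (PrimRec (Proj 0) (Comp Succ [Proj 1])) [x, y] (x + y)" for x y
  proof (induction x)
    case 0
    show ?case using rec_eval.proj[of 0 "[y]"] by (auto intro: rec_eval.prim_0)
  next
    case (Suc x)
    have "rec_eval (Comp Succ [Proj 1]) [x, x + y, y] (Suc (x + y))"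
      using rec_eval.proj[of 1 "[x, x + y, y]"]
      by (auto intro!: rec_eval.comp[where ys = "[x + y]"] rec_eval.succ)
    with Suc show ?case by (auto intro: rec_eval.prim_Suc)
  qed
  then show ?thesis by (auto simp: rec2_def)
qed

text \<open>The factor \<open>c\<close> is fixed, so the function is a repeated addition unfolded by
  induction on \<open>c\<close>.\<close>

lemma rec1_mult: "rec1 (\<lambda>x. c * x)"
proof (induction c)
  case 0
  show ?case by (rule rec1_recn) (simp add: recn_const)
next
  case (Suc c)
  show ?case
    by (rule rec1_recn) (auto intro!: recn_comp2[OF rec2_add] recn_comp1[OF Suc] recn_nth)
qed

lemma rec1_power: "rec1 (\<lambda>x. c ^ x)"
proof (rule rec1_primrec)
  show "rec2 (\<lambda>x y. c * y)" by (rule rec2_recn) (intro recn_comp1[OF rec1_mult] recn_nth, simp)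
qed simp

lemma rec1_triangle: "rec1 triangle"
proof (rule rec1_primrec)
  show "rec2 (\<lambda>n y. y + Suc n)"
    by (rule rec2_recn) (intro recn_comp2[OF rec2_add] recn_comp1[OF rec1_Suc] recn_nth, simp_all)
qed simp

definition cons_code :: "nat \<Rightarrow> nat \<Rightarrow> nat" where
  "cons_code x y = Suc (prod_encode (x, y))"

lemma list_encode_Cons: "list_encode (x # xs) = cons_code x (list_encode xs)"
  by (simp add: cons_code_def)

lemma rec2_prod_encode: "rec2 (\<lambda>x y. prod_encode (x, y))"
  unfolding prod_encode_def prod.case
  by (rule rec2_recn)
    (intro recn_comp2[OF rec2_add] recn_comp1[OF rec1_triangle] recn_nth; simp)

lemma rec2_cons_code: "rec2 cons_code"
  unfolding cons_code_def
  by (rule rec2_recn)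
    (intro recn_comp1[OF rec1_Suc] recn_comp2[OF rec2_prod_encode] recn_nth; simp)

text \<open>\<open>int_encode\<close> sends a nonnegative integer \<open>n\<close> to
  \<open>2 * n\<close>, and the denominator is 1.\<close>

lemma rat_code_of_nat: "rat_code (of_nat n) = prod_encode (2 * n, 1)"
  using quotient_of_int[of "int n"]
  by (simp add: rat_code_def Rat.of_int_def int_encode_def sum_encode_def)

section \<open>Runs and potentials\<close>

text \<open>Words grow at the end, since the value of an extended run only depends on the last
  state, the value so far and the product \<open>d\<close> of the inverse discount factors.\<close>

inductive apath :: "('a, 'q) nmda \<Rightarrow> 'a list \<Rightarrow> 'q \<Rightarrow> rat \<Rightarrow> rat \<Rightarrow> bool" for A where
  apath_Nil: "q \<in> initial A \<Longrightarrow> apath A [] q 0 1"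
| apath_snoc: "apath A w p y d \<Longrightarrow> (p, a, q) \<in> transitions A \<Longrightarrow>
    apath A (w @ [a]) q (y + weight A (p, a, q) * d) (d * (1 / discount A (p, a, q)))"

lemma runs_Nil_iff: "ps \<in> runs A [] \<longleftrightarrow> (\<exists>q\<in>initial A. ps = [q])"
  by (auto simp: runs_def length_Suc_conv)

lemma step_snoc:
  assumes "length ps = Suc (length w)"
  shows "i < length w \<Longrightarrow> step (w @ [a]) (ps @ [q]) i = step w ps i"
    and "step (w @ [a]) (ps @ [q]) (length w) = (last ps, a, q)"
proof -
  have "ps \<noteq> []" using assms by auto
  then show "step (w @ [a]) (ps @ [q]) (length w) = (last ps, a, q)"
    using assms by (simp add: step_def nth_append last_conv_nth)
  show "step (w @ [a]) (ps @ [q]) i = step w ps i" if "i < length w"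
    using assms that by (simp add: step_def nth_append)
qed

lemma runs_snoc_iff:
  "ps' \<in> runs A (w @ [a]) \<longleftrightarrow>
     (\<exists>ps q. ps' = ps @ [q] \<and> ps \<in> runs A w \<and> (last ps, a, q) \<in> transitions A)"
proof -
  have "ps @ [q] \<in> runs A (w @ [a]) \<longleftrightarrow> ps \<in> runs A w \<and> (last ps, a, q) \<in> transitions A"
    if "length ps = Suc (length w)" for ps q
    using that step_snoc[OF that] by (auto simp: runs_def less_Suc_eq nth_append)
  moreover have "\<exists>ps q. ps' = ps @ [q] \<and> length ps = Suc (length w)" if "ps' \<in> runs A (w @ [a])"
    using that by (cases ps' rule: rev_cases) (auto simp: runs_def)
  moreover have "length ps = Suc (length w)" if "ps \<in> runs A w" for ps
    using that by (simp add: runs_def)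
  ultimately show ?thesis by blast
qed

definition run_factor :: "('a, 'q) nmda \<Rightarrow> 'a list \<Rightarrow> 'q list \<Rightarrow> rat" where
  "run_factor A w ps = (\<Prod>j<length w. 1 / discount A (step w ps j))"

lemma run_snoc:
  assumes "ps \<in> runs A w"
  shows "run_value A (w @ [a]) (ps @ [q]) = run_value A w ps + weight A (last ps, a, q) * run_factor A w ps"
    and "run_factor A (w @ [a]) (ps @ [q]) = run_factor A w ps * (1 / discount A (last ps, a, q))"
proof -
  from assms have len: "length ps = Suc (length w)" by (simp add: runs_def)
  show "run_factor A (w @ [a]) (ps @ [q]) = run_factor A w ps * (1 / discount A (last ps, a, q))"
    using step_snoc[OF len] by (simp add: run_factor_def)
  show "run_value A (w @ [a]) (ps @ [q]) = run_value A w ps + weight A (last ps, a, q) * run_factor A w ps"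
    using step_snoc[OF len] by (simp add: run_value_def run_factor_def)
qed

lemma apath_iff_run:
  "apath A w q y d \<longleftrightarrow> (\<exists>ps\<in>runs A w. last ps = q \<and> run_value A w ps = y \<and> run_factor A w ps = d)"
proof
  assume "apath A w q y d"
  then show "\<exists>ps\<in>runs A w. last ps = q \<and> run_value A w ps = y \<and> run_factor A w ps = d"
  proof induction
    case (apath_Nil q)
    then show ?case
      by (auto simp: runs_Nil_iff run_value_def run_factor_def intro!: bexI[of _ "[q]"])
  next
    case (apath_snoc w p y d a q)
    then obtain ps where ps: "ps \<in> runs A w" "last ps = p" "run_value A w ps = y" "run_factor A w ps = d"
      by blast
    then have "ps @ [q] \<in> runs A (w @ [a])" using apath_snoc.hyps(2) by (auto simp: runs_snoc_iff)
    then show ?case using run_snoc[OF ps(1), of a q] ps by (intro bexI[of _ "ps @ [q]"]) auto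
  qed
next
  have "apath A w (last ps) (run_value A w ps) (run_factor A w ps)" if "ps \<in> runs A w" for ps
    using that
  proof (induction w arbitrary: ps rule: rev_induct)
    case Nil
    then show ?case by (auto simp: runs_Nil_iff run_value_def run_factor_def intro: apath.intros)
  next
    case (snoc a w)
    then obtain qs q where "ps = qs @ [q]" "qs \<in> runs A w" "(last qs, a, q) \<in> transitions A"
      by (auto simp: runs_snoc_iff)
    then show ?case using apath_snoc[OF snoc.IH] run_snoc[of qs A w a q] by simp
  qed
  moreover assume "\<exists>ps\<in>runs A w. last ps = q \<and> run_value A w ps = y \<and> run_factor A w ps = d"
  ultimately show "apath A w q y d" by blast
qed

section \<open>The automata of a counter graph\<close>

text \<open>\<open>Sig\<close> has to be the first letter of a word and sets counter 0 to its initial value.\<close>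

datatype letter = Sig | Edge edge

datatype state = Start | Mid | Found | Bad | Up nat | Dn nat | Reg "nat list"

instance instr :: countable by countable_datatype
instance letter :: countable by countable_datatype
instance state :: countable by countable_datatype

type_synonym trans = "state \<times> letter \<times> state"

text \<open>Since values are \<open>- pot / P\<close>, a higher potential or a smaller product
  lowers the value. The deterministic automaton ends in \<open>Found\<close> with potential 1 after
  reading an edge. Potential 2 undercuts it at any product that is not larger and marks words that
  are not edge sequences from \<open>s\<close> to \<open>t\<close>; a checker undercuts it only by
  reaching \<open>Found\<close> with a smaller product.\<close>

fun pot :: "nat list \<Rightarrow> state \<Rightarrow> nat" where
  "pot t Found = 1"
| "pot t Bad = 2"
| "pot t (Reg p) = (if p = t then 0 else 2)"
| "pot t q = 0"

text \<open>Reading instructions, \<open>Up k\<close> keeps its product at \<open>(2/3)\<^sup>c\<close> times that of the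
  deterministic automaton, where \<open>c\<close> is the value of counter \<open>k\<close>.  At a zero test, the factor 8
  makes this ratio \<open>8/6 \<cdot> (2/3)\<^sup>c\<close>, which is less than 1 iff \<open>c > 0\<close>.  Dually, at a decrement \<open>Dn k\<close>
  reaches the ratio \<open>5/6 \<cdot> (3/2)\<^sup>c\<close>, which is less than 1 iff \<open>c = 0\<close>.\<close>

fun chk :: "nat \<Rightarrow> nat \<Rightarrow> nat \<Rightarrow> letter \<Rightarrow> nat" where
  "chk k m n Sig = 6"
| "chk k m n (Edge (_, i, _)) = (if i = Inc k then m else if i = Dec k then n else 6)"

text \<open>One function serves both automata. On \<open>Sig\<close> the checkers of counter 0 start
  with the ratios \<open>(2/3)\<^sup>x\<close> and \<open>(3/2)\<^sup>x\<close> to the factor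
  \<open>6\<^sup>x\<close>, which encodes the initial value \<open>x\<close>.\<close>

definition fac :: "nat \<Rightarrow> trans \<Rightarrow> nat" where
  "fac x = (\<lambda>(q, a, q'). case q of
     Start \<Rightarrow> (if a = Sig then (case q' of Up _ \<Rightarrow> 4 ^ x | Dn _ \<Rightarrow> 9 ^ x | Mid \<Rightarrow> 6 ^ x | Start \<Rightarrow> 6 ^ x | _ \<Rightarrow> 6) else 6)
   | Up k \<Rightarrow> if q' = Found then 8 else chk k 4 9 a
   | Dn k \<Rightarrow> if q' = Found then 5 else chk k 9 4 a
   | _ \<Rightarrow> 6)"

fun wt :: "nat \<Rightarrow> nat list \<Rightarrow> trans \<Rightarrow> rat" where
  "wt x t (q, a, q') = of_nat (pot t q) - of_nat (pot t q') / of_nat (fac x (q, a, q'))"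

fun entry :: "nat \<Rightarrow> nat list \<Rightarrow> trans \<Rightarrow> (nat, nat) transition \<times> rat \<times> rat" where
  "entry x t (q, a, q') =
     ((to_nat q, to_nat a, to_nat q'), wt x t (q, a, q'), of_nat (fac x (q, a, q')))"

definition desc :: "nat \<Rightarrow> nat list \<Rightarrow> letter list \<Rightarrow> state list \<Rightarrow> trans list \<Rightarrow> nmda_desc" where
  "desc x t ls qs ts = (map to_nat ls, map to_nat qs, [to_nat Start], map (entry x t) ts)"

section \<open>Products of discount factors along paths\<close>

inductive gpath :: "trans set \<Rightarrow> nat \<Rightarrow> letter list \<Rightarrow> state \<Rightarrow> nat \<Rightarrow> bool" for T x where
  gpath_Nil: "gpath T x [] Start 1"
| gpath_snoc: "gpath T x w p P \<Longrightarrow> (p, a, q) \<in> T \<Longrightarrow> gpath T x (w @ [a]) q (P * fac x (p, a, q))"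

lemma gpath_Nil_iff: "gpath T x [] q P \<longleftrightarrow> q = Start \<and> P = 1"
  by (subst gpath.simps) auto

lemma gpath_snoc_iff:
  "gpath T x (w @ [a]) q P' \<longleftrightarrow> (\<exists>p P. gpath T x w p P \<and> (p, a, q) \<in> T \<and> P' = P * fac x (p, a, q))"
  by (subst gpath.simps) auto

lemma desc_simps:
  "alphabet (nmda_of (desc x t ls qs ts)) = to_nat ` set ls"
  "states (nmda_of (desc x t ls qs ts)) = to_nat ` set qs"
  "initial (nmda_of (desc x t ls qs ts)) = {to_nat Start}"
  "transitions (nmda_of (desc x t ls qs ts)) = (\<lambda>(q, a, q'). (to_nat q, to_nat a, to_nat q')) ` set ts"
  by (auto simp: desc_def image_image intro!: image_cong)

text \<open>Since \<open>to_nat\<close> is injective and the data of an entry are determined by its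
  transition, the first match is correct even if transitions are repeated.\<close>

lemma map_of_entry:
  "(q, a, q') \<in> set ts \<Longrightarrow> map_of (map (entry x t) ts) (to_nat q, to_nat a, to_nat q') =
     Some (wt x t (q, a, q'), of_nat (fac x (q, a, q')))"
proof (induction ts)
  case (Cons b ts)
  then show ?case by (cases b) (auto simp del: wt.simps)
qed simp

lemma desc_weight:
  assumes "(q, a, q') \<in> set ts"
  shows "weight (nmda_of (desc x t ls qs ts)) (to_nat q, to_nat a, to_nat q') = wt x t (q, a, q')"
    and "discount (nmda_of (desc x t ls qs ts)) (to_nat q, to_nat a, to_nat q') = of_nat (fac x (q, a, q'))"
  using map_of_entry[OF assms] by (simp_all add: desc_def)

text \<open>The weights \<open>wt\<close> make the values telescope.\<close>

lemma apath_desc_iff: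
  "apath (nmda_of (desc x t ls qs ts)) (map to_nat w) q' y d \<longleftrightarrow>
     (\<exists>q P. q' = to_nat q \<and> gpath (set ts) x w q P \<and> y = - of_nat (pot t q) / of_nat P \<and> d = 1 / of_nat P)"
    (is "apath ?A _ _ _ _ \<longleftrightarrow> _")
proof (induction w arbitrary: q' y d rule: rev_induct)
  case Nil
  have "apath ?A [] q' y d \<longleftrightarrow> q' = to_nat Start \<and> y = 0 \<and> d = 1"
    by (auto simp: desc_simps intro: apath_Nil elim: apath.cases)
  then show ?case by (auto simp: gpath_Nil_iff)
next
  case (snoc a w)
  have tel: "- of_nat (pot t q) / of_nat P + wt x t (q, a, q') * (1 / of_nat P) =
      - of_nat (pot t q') / of_nat (P * fac x (q, a, q'))" for q q' P
    by (simp add: divide_simps)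
  note weights = desc_weight[where t = t and x = x and ls = ls and qs = qs]
  have "\<exists>r P'. q' = to_nat r \<and> gpath (set ts) x (w @ [a]) r P' \<and>
      y = - of_nat (pot t r) / of_nat P' \<and> d = 1 / of_nat P'"
    if "apath ?A (map to_nat w @ [to_nat a]) q' y d"
  proof -
    from that obtain p y0 d0 where p: "apath ?A (map to_nat w) p y0 d0"
      "(p, to_nat a, q') \<in> transitions ?A" "y = y0 + weight ?A (p, to_nat a, q') * d0"
      "d = d0 * (1 / discount ?A (p, to_nat a, q'))"
      by (subst (asm) apath.simps) auto
    from p(1) obtain q P where q: "p = to_nat q" "gpath (set ts) x w q P"
      "y0 = - of_nat (pot t q) / of_nat P" "d0 = 1 / of_nat P"
      unfolding snoc.IH by blast
    from p(2) q(1) obtain r where r: "q' = to_nat r" "(q, a, r) \<in> set ts"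
      by (auto simp: desc_simps)
    have "y = - of_nat (pot t r) / of_nat (P * fac x (q, a, r))"
      unfolding tel[symmetric] using p(3) q(3,4) weights(1)[OF r(2)] unfolding q(1) r(1) by simp
    moreover have "d = 1 / of_nat (P * fac x (q, a, r))"
      using p(4) q(4) weights(2)[OF r(2)] unfolding q(1) r(1) by simp
    ultimately show ?thesis using r(1) gpath_snoc[OF q(2) r(2)] by blast
  qed
  moreover have "apath ?A (map to_nat w @ [to_nat a]) (to_nat r) (- of_nat (pot t r) / of_nat P') (1 / of_nat P')"
    if "gpath (set ts) x (w @ [a]) r P'" for r P'
  proof -
    from that obtain q P where q: "gpath (set ts) x w q P" "(q, a, r) \<in> set ts" "P' = P * fac x (q, a, r)"
      by (auto simp: gpath_snoc_iff)
    then have "apath ?A (map to_nat w) (to_nat q) (- of_nat (pot t q) / of_nat P) (1 / of_nat P)"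
      unfolding snoc.IH by blast
    moreover have "(to_nat q, to_nat a, to_nat r) \<in> transitions ?A"
      using q(2) by (force simp: desc_simps)
    ultimately have "apath ?A (map to_nat w @ [to_nat a]) (to_nat r)
        (- of_nat (pot t q) / of_nat P + wt x t (q, a, r) * (1 / of_nat P))
        (1 / of_nat P * (1 / of_nat (fac x (q, a, r))))"
      unfolding weights[OF q(2), symmetric] by (rule apath_snoc)
    then show ?thesis unfolding tel q(3) by simp
  qed
  ultimately show ?case by auto
qed

definition path_values :: "trans set \<Rightarrow> nat \<Rightarrow> nat list \<Rightarrow> letter list \<Rightarrow> rat set" where
  "path_values T x t w = {- of_nat (pot t q) / of_nat P |q P. gpath T x w q P}"

lemma word_value_desc:
  "word_value (nmda_of (desc x t ls qs ts)) (map to_nat w) =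
     (INF y\<in>path_values (set ts) x t w. ereal (of_rat y))"
proof -
  let ?A = "nmda_of (desc x t ls qs ts)"
  have "run_value ?A (map to_nat w) ` runs ?A (map to_nat w) = {y. \<exists>q d. apath ?A (map to_nat w) q y d}"
    by (auto simp: apath_iff_run)
  also have "\<dots> = path_values (set ts) x t w"
    unfolding apath_desc_iff path_values_def by auto
  finally show ?thesis unfolding word_value_def by (metis image_image)
qed

lemma finite_path_values:
  assumes "finite T"
  shows "finite (path_values T x t w)"
proof -
  have "finite {(q, P). gpath T x w q P}"
  proof (induction w rule: rev_induct)
    case Nil
    have "{(q, P). gpath T x [] q P} = {(Start, 1)}" by (auto simp: gpath_Nil_iff)
    then show ?case by simp
  next
    case (snoc a w)
    have "{(q, P). gpath T x (w @ [a]) q P} \<subseteq>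
        (\<lambda>((p, P), t). (snd (snd t), P * fac x t)) ` ({(q, P). gpath T x w q P} \<times> T)"
      by (force simp: gpath_snoc_iff)
    then show ?case using snoc assms by (meson finite_SigmaI finite_imageI finite_subset)
  qed
  then have "finite ((\<lambda>(q, P). - of_nat (pot t q) / of_nat P) ` {(q, P). gpath T x w q P} :: rat set)"
    by (rule finite_imageI)
  moreover have "path_values T x t w = (\<lambda>(q, P). - of_nat (pot t q) / of_nat P) ` {(q, P). gpath T x w q P}"
    by (auto simp: path_values_def)
  ultimately show ?thesis by simp
qed

text \<open>The infimum over the finite set \<open>B\<close> is attained, which keeps the inequality
  strict.\<close>

lemma INF_less_INF:
  fixes A B :: "rat set"
  assumes "finite B" "B \<noteq> {}" "\<And>z. z \<in> B \<Longrightarrow> \<exists>y\<in>A. y < z"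
  shows "(INF y\<in>A. ereal (of_rat y)) < (INF z\<in>B. ereal (of_rat z))"
proof -
  let ?f = "\<lambda>y. ereal (of_rat y)"
  have "Inf (?f ` B) = Min (?f ` B)" using assms by (intro Min_Inf[symmetric]) auto
  moreover have "Min (?f ` B) \<in> ?f ` B" using assms by (intro Min_in) auto
  ultimately obtain z where z: "z \<in> B" "Inf (?f ` B) = ?f z" by auto
  then obtain y where "y \<in> A" "y < z" using assms(3) by blast
  then have "Inf (?f ` A) \<le> ?f y" "?f y < ?f z" by (auto intro: INF_lower simp: of_rat_less)
  then show ?thesis unfolding z(2) by (rule le_less_trans)
qed

text \<open>Here the edges only have to fit together, whereas \<open>xpath\<close> below also
  executes their instructions. A word can fail to be a computation at either level.\<close>

inductive lpath :: "edge set \<Rightarrow> nat list \<Rightarrow> edge list \<Rightarrow> nat list \<Rightarrow> bool" for E s where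
  lpath_Nil: "lpath E s [] s"
| lpath_snoc: "lpath E s us p \<Longrightarrow> (p, i, q) \<in> E \<Longrightarrow> lpath E s (us @ [(p, i, q)]) q"

inductive xpath :: "edge set \<Rightarrow> nat list \<Rightarrow> store \<Rightarrow> edge list \<Rightarrow> nat list \<Rightarrow> store \<Rightarrow> bool" for E s v0 where
  xpath_Nil: "xpath E s v0 [] s v0"
| xpath_snoc: "xpath E s v0 us p v \<Longrightarrow> (p, i, q) \<in> E \<Longrightarrow> exec i v v' \<Longrightarrow>
    xpath E s v0 (us @ [(p, i, q)]) q v'"

lemma xpath_Nil_iff: "xpath E s v0 [] p v \<longleftrightarrow> p = s \<and> v = v0"
  by (subst xpath.simps) auto

lemma gsteps_iff_xpath: "(gstep E)\<^sup>*\<^sup>* (s, v0) (p, v) \<longleftrightarrow> (\<exists>us. xpath E s v0 us p v)"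
proof
  have "\<exists>us. xpath E s v0 us (fst c) (snd c)" if "(gstep E)\<^sup>*\<^sup>* (s, v0) c" for c
    using that
  proof (induction rule: rtranclp_induct)
    case base
    show ?case by (auto intro: xpath_Nil)
  next
    case (step c d)
    from step.hyps(2) step.IH show ?case by (cases rule: gstep.cases) (auto intro: xpath_snoc)
  qed
  then show "(gstep E)\<^sup>*\<^sup>* (s, v0) (p, v) \<Longrightarrow> \<exists>us. xpath E s v0 us p v" by fastforce
  have "(gstep E)\<^sup>*\<^sup>* (s, v0) (p, v)" if "xpath E s v0 us p v" for us
    using that by induction (auto intro: gstepI rtranclp.rtrancl_into_rtrancl)
  then show "\<exists>us. xpath E s v0 us p v \<Longrightarrow> (gstep E)\<^sup>*\<^sup>* (s, v0) (p, v)" by blast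
qed

text \<open>On \<open>Sig\<close> the automaton decides to check the edges by \<open>Reg\<close>,
  counter 0, or another counter. In the last case \<open>Mid\<close> delays the choice of the
  counter by one letter, so that the number of transitions with input-dependent factors does not
  grow with \<open>K\<close>.\<close>

fun succs :: "nat list \<Rightarrow> nat \<Rightarrow> state \<Rightarrow> letter \<Rightarrow> state set" where
  "succs s K Start Sig = {Up 0, Dn 0, Mid, Reg s}"
| "succs s K Start (Edge e) = {Bad}"
| "succs s K Mid a = Up ` {1..K} \<union> Dn ` {1..K}"
| "succs s K Found a = {Found}"
| "succs s K Bad a = {Bad}"
| "succs s K (Up k) Sig = {Up k}"
| "succs s K (Up k) (Edge (p, i, q)) = {Up k} \<union> (if i = Zer k then {Found} else {})"
| "succs s K (Dn k) Sig = {Dn k}"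
| "succs s K (Dn k) (Edge (p, i, q)) = {Dn k} \<union> (if i = Dec k then {Found} else {})"
| "succs s K (Reg p) Sig = {Bad}"
| "succs s K (Reg p) (Edge (p', i, q)) = (if p = p' then {Reg q} else {Bad})"

definition letters :: "edge set \<Rightarrow> letter set" where
  "letters E = insert Sig (Edge ` E)"

definition nstates :: "edge set \<Rightarrow> nat list \<Rightarrow> nat list \<Rightarrow> nat \<Rightarrow> state set" where
  "nstates E s t K = {Start, Mid, Found, Bad} \<union> Up ` {..K} \<union> Dn ` {..K} \<union>
     Reg ` ({s, t} \<union> fst ` E \<union> (snd \<circ> snd) ` E)"

definition ntrans :: "edge set \<Rightarrow> nat list \<Rightarrow> nat list \<Rightarrow> nat \<Rightarrow> trans set" where
  "ntrans E s t K = {(q, a, q'). q \<in> nstates E s t K \<and> a \<in> letters E \<and> q' \<in> succs s K q a}"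

text \<open>Completeness is achieved by the loop at \<open>Start\<close>, on which the factor
  \<open>6\<^sup>x\<close> may be repeated. Words that are not of the form \<open>code us\<close>
  are handled by a lower bound for the product.\<close>

definition dtrans :: "edge set \<Rightarrow> trans set" where
  "dtrans E = insert (Start, Sig, Start)
     ((\<lambda>e. (Start, Edge e, Found)) ` E \<union> (\<lambda>a. (Found, a, Found)) ` letters E)"

section \<open>Arithmetic of the discount factors\<close>

text \<open>The invariant is \<open>P / D = (c / b) ^ v k\<close>, cross-multiplied to stay within
  the natural numbers. It forces the factors \<open>6 * c / b\<close> for an increment and
  \<open>6 * b / c\<close> for a decrement. \<open>Up\<close> has \<open>b = 3\<close> and
  \<open>c = 2\<close>, and \<open>Dn\<close> has them exchanged.\<close>

lemma chk_step:
  fixes P D :: nat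
  assumes "exec i v v'" "m * b = 6 * c" "n * c = 6 * b" "b > 0" "P * b ^ v k = D * c ^ v k"
  shows "P * chk k m n (Edge (p, i, q)) * b ^ v' k = 6 * D * c ^ v' k"
proof -
  consider "i = Inc k" | "i = Dec k" | "v' k = v k" "i \<noteq> Inc k" "i \<noteq> Dec k"
    using assms(1) by (cases i) auto
  then show ?thesis
  proof cases
    case 1
    then have "P * m * b ^ Suc (v k) = (P * b ^ v k) * (m * b)" by simp
    also have "\<dots> = 6 * D * c ^ Suc (v k)" unfolding assms(2,5) by simp
    finally show ?thesis using 1 assms(1) by simp
  next
    case 2
    then obtain r where r: "v k = Suc r" "v' k = r" using assms(1) by (cases "v k") auto
    have "b * (P * n * b ^ r) = n * (P * b ^ v k)" unfolding r by simp
    also have "\<dots> = (n * c) * (D * c ^ r)" unfolding assms(5) unfolding r by simp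
    also have "\<dots> = b * (6 * D * c ^ r)" unfolding assms(3) by simp
    finally have "P * n * b ^ r = 6 * D * c ^ r" using assms(4) by simp
    then show ?thesis using 2 r by simp
  next
    case 3
    then show ?thesis using assms(5) by simp
  qed
qed

lemma chk_gt_1: "1 < m \<Longrightarrow> 1 < n \<Longrightarrow> 1 < chk k m n a"
  by (cases "(k, m, n, a)" rule: chk.cases) auto

lemma fac_gt_1:
  assumes "x > 0"
  shows "1 < fac x tr"
proof -
  have "1 < (4::nat) ^ x" "1 < (9::nat) ^ x" "1 < (6::nat) ^ x"
    by (rule one_less_power; use assms in simp)+
  moreover have "1 < chk k 4 9 a" "1 < chk k 9 4 a" for k a by (rule chk_gt_1; simp)+
  moreover obtain q a q' where "tr = (q, a, q')" by (cases tr)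
  ultimately show ?thesis by (cases q; cases q') (simp_all add: fac_def del: One_nat_def)
qed

text \<open>\<open>K\<close> bounds the counters that can be misused; a counter that is only
  incremented never blocks. \<open>K > 0\<close> provides successors of \<open>Mid\<close>, and
  \<open>x > 0\<close> makes the powers on \<open>Sig\<close> admissible as discount
  factors.\<close>

locale counter_graph =
  fixes E :: "edge set" and s t :: "nat list" and K x :: nat
  assumes finite_E: "finite E"
    and s_neq_t: "s \<noteq> t"
    and start_Nop: "(s, i, q) \<in> E \<Longrightarrow> i = Nop"
    and Dec_le: "(p, Dec k, q) \<in> E \<Longrightarrow> k \<le> K"
    and Zer_le: "(p, Zer k, q) \<in> E \<Longrightarrow> k \<le> K"
    and K_pos: "K > 0"
    and x_pos: "x > 0"
begin

abbreviation "NT \<equiv> ntrans E s t K"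
abbreviation "DT \<equiv> dtrans E"
abbreviation "v0 \<equiv> (\<lambda>_. 0)(0 := x) :: store"
abbreviation "lp \<equiv> lpath E s"
abbreviation "xp \<equiv> xpath E s v0"
abbreviation "code us \<equiv> Sig # map Edge us"

section \<open>Runs of the nondeterministic automaton\<close>

lemma lpath_nstates: "lp us p \<Longrightarrow> Reg p \<in> nstates E s t K"
proof (induction rule: lpath.induct)
  case (lpath_snoc us p i q)
  then have "q \<in> (snd \<circ> snd) ` E" using imageI[of "(p, i, q)" E "snd \<circ> snd"] by simp
  then show ?case by (simp add: nstates_def)
qed (simp add: nstates_def)

lemma gpathI:
  assumes "gpath NT x w p P" "p \<in> nstates E s t K" "a \<in> letters E" "q \<in> succs s K p a"
    "P' = P * fac x (p, a, q)"
  shows "gpath NT x (w @ [a]) q P'"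
proof -
  have "(p, a, q) \<in> NT" using assms(2-4) by (simp add: ntrans_def)
  from gpath_snoc[OF assms(1) this] show ?thesis unfolding assms(5) .
qed

lemma gpath_SigI:
  "q \<in> succs s K Start Sig \<Longrightarrow> P = fac x (Start, Sig, q) \<Longrightarrow> gpath NT x [Sig] q P"
  using gpathI[OF gpath_Nil, of Sig q P] by (simp add: nstates_def letters_def)

lemma gpath_codeI:
  assumes "gpath NT x (code us) p P" "p \<in> nstates E s t K" "e \<in> E" "q \<in> succs s K p (Edge e)"
    "P' = P * fac x (p, Edge e, q)"
  shows "gpath NT x (code (us @ [e])) q P'"
proof -
  have "Edge e \<in> letters E" using assms(3) by (simp add: letters_def)
  from gpathI[OF assms(1,2) this assms(4,5)] show ?thesis by simp
qed

text \<open>\<open>Reg\<close> follows the edges like a finite automaton and falls into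
  \<open>Bad\<close> at the first misfit, with factor 6 throughout, even on the initial
  \<open>Sig\<close>.\<close>

lemma register_path:
  assumes "w \<noteq> []" "set w \<subseteq> letters E"
  shows "gpath NT x w Bad (6 ^ length w) \<or>
    (\<exists>us p. w = code us \<and> lp us p \<and> gpath NT x w (Reg p) (6 ^ length w))"
  using assms
proof (induction w rule: rev_induct)
  case (snoc a w)
  then have a: "a \<in> letters E" by simp
  show ?case
  proof (cases "w = []")
    case True
    show ?thesis
    proof (cases a)
      case Sig
      have "gpath NT x [Sig] (Reg s) 6" by (rule gpath_SigI) (auto simp: fac_def)
      then show ?thesis using True Sig lpath_Nil[of E s] by auto
    next
      case (Edge e)
      have "gpath NT x ([] @ [a]) Bad 6"
        by (rule gpathI[OF gpath_Nil]) (use Edge a in \<open>auto simp: nstates_def fac_def\<close>)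
      then show ?thesis using True by simp
    qed
  next
    case False
    with snoc.IH snoc.prems consider "gpath NT x w Bad (6 ^ length w)"
      | us p where "w = code us" "lp us p" "gpath NT x w (Reg p) (6 ^ length w)" by auto
    then show ?thesis
    proof cases
      case 1
      then have "gpath NT x (w @ [a]) Bad (6 ^ length (w @ [a]))"
        by (rule gpathI) (use a in \<open>auto simp: nstates_def fac_def\<close>)
      then show ?thesis ..
    next
      case 2
      note next_state = gpathI[OF 2(3) lpath_nstates[OF 2(2)] a]
      show ?thesis
      proof (cases "\<exists>i q. a = Edge (p, i, q)")
        case True
        then obtain i q where aeq: "a = Edge (p, i, q)" by blast
        with a have "lp (us @ [(p, i, q)]) q" using 2(2) by (auto simp: letters_def intro: lpath_snoc)
        moreover have "gpath NT x (w @ [a]) (Reg q) (6 ^ length (w @ [a]))"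
          by (rule next_state) (auto simp: aeq fac_def)
        moreover have "w @ [a] = code (us @ [(p, i, q)])" using 2(1) aeq by simp
        ultimately show ?thesis by blast
      next
        case False
        then have "Bad \<in> succs s K (Reg p) a" by (cases a) auto
        then have "gpath NT x (w @ [a]) Bad (6 ^ length (w @ [a]))"
          by (rule next_state) (auto simp: fac_def)
        then show ?thesis ..
      qed
    qed
  qed
qed simp

text \<open>A checker for \<open>k \<noteq> 0\<close> is entered from \<open>Mid\<close> on the
  first edge. That edge is a \<open>Nop\<close> and counter \<open>k\<close> is still 0, so starting
  with ratio 1 is correct.\<close>

lemma checker_path:
  assumes "xp us p v" "k \<le> K" "us \<noteq> [] \<or> k = 0"
  shows "(\<exists>P. gpath NT x (code us) (Up k) P \<and> P * 3 ^ v k = 6 ^ (x + length us) * 2 ^ v k) \<and>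
    (\<exists>P. gpath NT x (code us) (Dn k) P \<and> P * 2 ^ v k = 6 ^ (x + length us) * 3 ^ v k)"
  using assms
proof (induction rule: xpath.induct)
  case xpath_Nil
  have "gpath NT x [Sig] (Up 0) (4 ^ x)" "gpath NT x [Sig] (Dn 0) (9 ^ x)"
    by (rule gpath_SigI; simp add: fac_def)+
  then show ?case using xpath_Nil by (auto simp flip: power_mult_distrib)
next
  case (xpath_snoc us p v i q v')
  have states: "Up k \<in> nstates E s t K" "Dn k \<in> nstates E s t K" "Mid \<in> nstates E s t K"
    using xpath_snoc.prems by (auto simp: nstates_def)
  show ?case
  proof (cases "us = [] \<and> k \<noteq> 0")
    case True
    then have "p = s" "v = v0" using xpath_snoc.hyps(1) by (auto simp: xpath_Nil_iff)
    moreover from this have "i = Nop" using start_Nop xpath_snoc.hyps(2) by blast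
    ultimately have "v' k = 0" using xpath_snoc.hyps(3) True by simp
    have "gpath NT x (code []) Mid (6 ^ x)" using gpath_SigI[of Mid] by (simp add: fac_def)
    then have "gpath NT x (code ([] @ [(p, i, q)])) (Up k) (6 ^ x * 6)"
      "gpath NT x (code ([] @ [(p, i, q)])) (Dn k) (6 ^ x * 6)"
      by (rule gpath_codeI; use states xpath_snoc True in \<open>auto simp: fac_def\<close>)+
    then show ?thesis using True \<open>v' k = 0\<close> by (auto simp: mult.commute)
  next
    case False
    with xpath_snoc obtain P Q where P: "gpath NT x (code us) (Up k) P" "P * 3 ^ v k = 6 ^ (x + length us) * 2 ^ v k"
      and Q: "gpath NT x (code us) (Dn k) Q" "Q * 2 ^ v k = 6 ^ (x + length us) * 3 ^ v k" by auto
    let ?e = "(p, i, q)"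
    have "gpath NT x (code (us @ [?e])) (Up k) (P * chk k 4 9 (Edge ?e))"
      by (rule gpath_codeI[OF P(1)]) (use states xpath_snoc in \<open>auto simp: fac_def\<close>)
    moreover have "P * chk k 4 9 (Edge ?e) * 3 ^ v' k = 6 * 6 ^ (x + length us) * 2 ^ v' k"
      by (rule chk_step[OF xpath_snoc.hyps(3) _ _ _ P(2)]) auto
    moreover have "gpath NT x (code (us @ [?e])) (Dn k) (Q * chk k 9 4 (Edge ?e))"
      by (rule gpath_codeI[OF Q(1)]) (use states xpath_snoc in \<open>auto simp: fac_def\<close>)
    moreover have "Q * chk k 9 4 (Edge ?e) * 2 ^ v' k = 6 * 6 ^ (x + length us) * 3 ^ v' k"
      by (rule chk_step[OF xpath_snoc.hyps(3) _ _ _ Q(2)]) auto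
    ultimately show ?thesis by (auto simp del: chk.simps)
  qed
qed

text \<open>An instruction that is not enabled can only be a decrement at zero or a zero test at a
  positive value, which the checkers \<open>Dn\<close> and \<open>Up\<close> report by passing to \<open>Found\<close>.\<close>

lemma failure_path:
  assumes "lp us p"
  shows "(\<exists>v. xp us p v) \<or> (\<exists>P. gpath NT x (code us) Found P \<and> P < 6 ^ (x + length us))"
  using assms
proof (induction rule: lpath.induct)
  case lpath_Nil
  then show ?case using xpath_Nil by blast
next
  case (lpath_snoc us p i q)
  from lpath_snoc.IH show ?case
  proof
    assume "\<exists>P. gpath NT x (code us) Found P \<and> P < 6 ^ (x + length us)"
    then obtain P where P: "gpath NT x (code us) Found P" "P < 6 ^ (x + length us)" by blast
    have "gpath NT x (code (us @ [(p, i, q)])) Found (P * 6)"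
      by (rule gpath_codeI[OF P(1)]) (use lpath_snoc in \<open>auto simp: fac_def nstates_def\<close>)
    then show ?thesis using P(2) by (intro disjI2 exI[of _ "P * 6"]) auto
  next
    assume "\<exists>v. xp us p v"
    then obtain v where v: "xp us p v" by blast
    show ?thesis
    proof (cases "\<exists>v'. exec i v v'")
      case True
      then show ?thesis using v lpath_snoc.hyps(2) by (blast intro: xpath_snoc)
    next
      case False
      then consider k where "i = Dec k" "v k = 0" | k where "i = Zer k" "v k > 0" by (cases i) auto
      then show ?thesis
      proof cases
        case 1
        have "us \<noteq> []" using v lpath_snoc.hyps(2) start_Nop[of i q] 1 by (auto simp: xpath_Nil_iff)
        moreover have "k \<le> K" using 1 Dec_le lpath_snoc.hyps(2) by blast
        ultimately have P: "gpath NT x (code us) (Dn k) (6 ^ (x + length us))"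
          using checker_path[OF v, of k] 1 by auto
        have "gpath NT x (code (us @ [(p, i, q)])) Found (6 ^ (x + length us) * 5)"
          by (rule gpath_codeI[OF P])
            (use lpath_snoc 1 \<open>k \<le> K\<close> in \<open>auto simp: fac_def nstates_def\<close>)
        then show ?thesis by (intro disjI2 exI[of _ "6 ^ (x + length us) * 5"]) auto
      next
        case 2
        have "us \<noteq> []" using v lpath_snoc.hyps(2) start_Nop[of i q] 2 by (auto simp: xpath_Nil_iff)
        moreover have "k \<le> K" using 2 Zer_le lpath_snoc.hyps(2) by blast
        ultimately obtain P where P: "gpath NT x (code us) (Up k) P"
          "P * 3 ^ v k = 6 ^ (x + length us) * 2 ^ v k"
          using checker_path[OF v, of k] by auto
        have "gpath NT x (code (us @ [(p, i, q)])) Found (P * 8)"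
          by (rule gpath_codeI[OF P(1)])
            (use lpath_snoc 2 \<open>k \<le> K\<close> in \<open>auto simp: fac_def nstates_def\<close>)
        moreover have "P * 8 < 6 * 6 ^ (x + length us)"
        proof -
          \<comment> \<open>A single factor 2/3 suffices, as \<open>8 * 2 / 3 < 6\<close>; further
            ones only decrease the product.\<close>
          obtain r where r: "v k = Suc r" using 2 by (cases "v k") auto
          have "(2::nat) ^ r \<le> 3 ^ r" by (intro power_mono) auto
          then have "6 ^ (x + length us) * (2::nat) ^ r \<le> 6 ^ (x + length us) * 3 ^ r"
            by (intro mult_left_mono) auto
          moreover have "(P * 3) * 3 ^ r = 2 * (6 ^ (x + length us) * 2 ^ r)"
            using P(2) unfolding r by simp
          ultimately have "(P * 3) * 3 ^ r \<le> (2 * 6 ^ (x + length us)) * 3 ^ r" by simp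
          then have "P * 3 \<le> 2 * 6 ^ (x + length us)" by simp
          moreover have "(6::nat) ^ (x + length us) > 0" by simp
          ultimately show ?thesis by linarith
        qed
        ultimately show ?thesis by (intro disjI2 exI[of _ "P * 8"]) auto
      qed
    qed
  qed
qed

text \<open>Invariant of all runs along a valid execution, where the registers never reach
  \<open>Bad\<close>. A false alarm leads to \<open>Found\<close> with a product above that of the
  deterministic automaton, hence to a greater value.\<close>

definition good :: "edge list \<Rightarrow> nat list \<Rightarrow> store \<Rightarrow> state \<Rightarrow> nat \<Rightarrow> bool" where
  "good us p v q P \<longleftrightarrow> (case q of
     Start \<Rightarrow> False | Bad \<Rightarrow> False
   | Mid \<Rightarrow> us = [] \<and> P = 6 ^ x
   | Found \<Rightarrow> 6 ^ (x + length us) < P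
   | Up k \<Rightarrow> P * 3 ^ v k = 6 ^ (x + length us) * 2 ^ v k
   | Dn k \<Rightarrow> P * 2 ^ v k = 6 ^ (x + length us) * 3 ^ v k
   | Reg p' \<Rightarrow> p' = p)"

text \<open>False alarms raise the product: reporting a zero test at 0 gives the ratio
  \<open>8/6\<close>, and reporting a decrement at a positive value gives at least
  \<open>5/6 * 3/2\<close>. Later factors are 6 in both automata.\<close>

lemma valid_path:
  assumes "xp us p v" "gpath NT x (code us) q P"
  shows "good us p v q P"
  using assms
proof (induction arbitrary: q P rule: xpath.induct)
  case xpath_Nil
  then have "gpath NT x ([] @ [Sig]) q P" by simp
  then have "q \<in> {Up 0, Dn 0, Mid, Reg s}" "P = fac x (Start, Sig, q)"
    unfolding gpath_snoc_iff gpath_Nil_iff by (auto simp: ntrans_def)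
  then show ?case by (auto simp: fac_def good_def simp flip: power_mult_distrib)
next
  case (xpath_snoc us p v i p' v')
  let ?e = "(p, i, p')"
  from xpath_snoc.prems have "gpath NT x (code us @ [Edge ?e]) q P" by simp
  then obtain q0 P0 where q0: "gpath NT x (code us) q0 P0" "q \<in> succs s K q0 (Edge ?e)"
    and P: "P = P0 * fac x (q0, Edge ?e, q)"
    unfolding gpath_snoc_iff by (auto simp: ntrans_def)
  have IH: "good us p v q0 P0" by (rule xpath_snoc.IH[OF q0(1)])
  show ?case
  proof (cases q0)
    case Mid
    then have us: "us = []" "P0 = 6 ^ x" using IH by (auto simp: good_def)
    then have "p = s" "v = v0" using xpath_snoc.hyps(1) by (auto simp: xpath_Nil_iff)
    moreover from this have "i = Nop" using start_Nop xpath_snoc.hyps(2) by blast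
    ultimately have "v' = v0" "i = Nop" "v = v0" using xpath_snoc.hyps(3) by simp_all
    then show ?thesis using Mid us q0(2) P by (auto simp: good_def fac_def)
  next
    case Found
    then show ?thesis using IH q0(2) P by (auto simp: good_def fac_def)
  next
    case (Up k)
    then have P0: "P0 * 3 ^ v k = 6 ^ (x + length us) * 2 ^ v k" using IH by (simp add: good_def)
    from q0(2) Up consider "q = Up k" | "q = Found" "i = Zer k" by (auto split: if_splits)
    then show ?thesis
    proof cases
      case 1
      have "P0 * chk k 4 9 (Edge ?e) * 3 ^ v' k = 6 * 6 ^ (x + length us) * 2 ^ v' k"
        by (rule chk_step[OF xpath_snoc.hyps(3) _ _ _ P0]) auto
      then show ?thesis using 1 Up P by (simp add: good_def fac_def del: chk.simps)
    next
      case 2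
      then have "v k = 0" using xpath_snoc.hyps(3) by simp
      then show ?thesis using 2 Up P P0 by (simp add: good_def fac_def)
    qed
  next
    case (Dn k)
    then have P0: "P0 * 2 ^ v k = 6 ^ (x + length us) * 3 ^ v k" using IH by (simp add: good_def)
    from q0(2) Dn consider "q = Dn k" | "q = Found" "i = Dec k" by (auto split: if_splits)
    then show ?thesis
    proof cases
      case 1
      have "P0 * chk k 9 4 (Edge ?e) * 2 ^ v' k = 6 * 6 ^ (x + length us) * 3 ^ v' k"
        by (rule chk_step[OF xpath_snoc.hyps(3) _ _ _ P0]) auto
      then show ?thesis using 1 Dn P by (simp add: good_def fac_def del: chk.simps)
    next
      case 2
      then obtain r where r: "v k = Suc r" using xpath_snoc.hyps(3) by (cases "v k") auto
      have "(2::nat) ^ r \<le> 3 ^ r" by (intro power_mono) auto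
      then have "6 ^ (x + length us) * (2::nat) ^ r \<le> 6 ^ (x + length us) * 3 ^ r"
        by (intro mult_left_mono) auto
      moreover have "(2 * P0) * 2 ^ r = 3 * (6 ^ (x + length us) * 3 ^ r)"
        using P0 unfolding r by simp
      ultimately have "(3 * 6 ^ (x + length us)) * 2 ^ r \<le> (2 * P0) * 2 ^ r" by simp
      then have "3 * 6 ^ (x + length us) \<le> 2 * P0" by simp
      moreover have "(6::nat) ^ (x + length us) > 0" by simp
      ultimately have "6 * 6 ^ (x + length us) < P0 * 5" by linarith
      then show ?thesis using 2 Dn P by (simp add: good_def fac_def)
    qed
  next
    case (Reg r)
    then show ?thesis using IH q0(2) P by (auto simp: good_def)
  qed (use IH in \<open>auto simp: good_def\<close>)
qed

section \<open>Runs of the deterministic automaton\<close>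

lemma dpath_bound:
  "gpath DT x w q P \<Longrightarrow> (q = Start \<or> q = Found) \<and> 6 ^ length w \<le> P"
proof (induction rule: gpath.induct)
  case (gpath_snoc w p P a q)
  have "(6::nat) ^ 1 \<le> 6 ^ x" using x_pos by (intro power_increasing) auto
  then have "6 \<le> fac x (p, a, q)" using gpath_snoc.hyps(2) by (auto simp: dtrans_def fac_def)
  then have "6 ^ length w * 6 \<le> P * fac x (p, a, q)" using gpath_snoc.IH by (intro mult_mono) auto
  then show ?case using gpath_snoc.hyps(2) by (auto simp: dtrans_def)
qed simp

lemma dpath_code:
  assumes "gpath DT x (code us) q P"
  shows "P = 6 ^ (x + length us) \<and> q = (if us = [] then Start else Found)"
  using assms
proof (induction us arbitrary: q P rule: rev_induct)
  case Nil
  then have "gpath DT x ([] @ [Sig]) q P" by simp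
  then show ?case unfolding gpath_snoc_iff gpath_Nil_iff by (auto simp: dtrans_def fac_def)
next
  case (snoc e us)
  then have "gpath DT x (code us @ [Edge e]) q P" by simp
  then obtain q0 P0 where q0: "gpath DT x (code us) q0 P0" "(q0, Edge e, q) \<in> DT"
    "P = P0 * fac x (q0, Edge e, q)"
    unfolding gpath_snoc_iff by blast
  with snoc.IH[OF q0(1)] show ?case by (auto simp: dtrans_def fac_def split: if_splits)
qed

lemma dpath_exists: "set w \<subseteq> letters E \<Longrightarrow> \<exists>q P. gpath DT x w q P"
proof (induction w rule: rev_induct)
  case Nil
  show ?case by (auto simp: gpath_Nil_iff)
next
  case (snoc a w)
  then obtain q P where q: "gpath DT x w q P" by auto
  with dpath_bound[OF q] snoc.prems have "\<exists>q'. (q, a, q') \<in> DT" by (auto simp: dtrans_def letters_def)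
  with q show ?case by (blast intro: gpath_snoc)
qed

section \<open>Comparison of the values on a single word\<close>

definition accepted :: "letter list \<Rightarrow> bool" where
  "accepted w \<longleftrightarrow> (\<exists>us v. w = code us \<and> xp us t v)"

abbreviation "NV w \<equiv> path_values NT x t w"
abbreviation "DV w \<equiv> path_values DT x t w"

lemma DV_nonempty: "set w \<subseteq> letters E \<Longrightarrow> DV w \<noteq> {}"
  using dpath_exists by (force simp: path_values_def)

lemma DV_bound:
  assumes "z \<in> DV w"
  shows "- 1 / 6 ^ length w \<le> z"
proof -
  from assms obtain q P where q: "gpath DT x w q P" "z = - of_nat (pot t q) / of_nat P"
    by (auto simp: path_values_def)
  with dpath_bound[OF q(1)] have P: "6 ^ length w \<le> P" and "pot t q \<le> 1" by auto
  have "(6::rat) ^ length w \<le> of_nat P" using P by (metis of_nat_le_iff of_nat_numeral of_nat_power)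
  then have "(of_nat (pot t q) :: rat) / of_nat P \<le> 1 / 6 ^ length w"
    using \<open>pot t q \<le> 1\<close> by (intro frac_le) auto
  then show ?thesis using q(2) by simp
qed

lemma DV_code:
  assumes "us \<noteq> []" "z \<in> DV (code us)"
  shows "z = - 1 / 6 ^ (x + length us)"
proof -
  from assms(2) obtain q P where "gpath DT x (code us) q P" "z = - of_nat (pot t q) / of_nat P"
    by (auto simp: path_values_def)
  with dpath_code[OF this(1)] assms(1) show ?thesis by simp
qed

lemma code_neq_Nil: "lp us t \<Longrightarrow> us \<noteq> []"
  using s_neq_t by (auto elim: lpath.cases)

lemma xpath_lpath: "xp us p v \<Longrightarrow> lp us p"
  by (induction rule: xpath.induct) (auto intro: lpath.intros)

text \<open>Each run of the nondeterministic automaton either has raised a false alarm and has too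
  large a product, or ends with potential 0 and value 0, above the negative value of the
  deterministic run.\<close>

lemma accepted_greater:
  assumes "set w \<subseteq> letters E" "accepted w" "y \<in> NV w"
  shows "\<exists>z\<in>DV w. z < y"
proof -
  from assms(2) obtain us v where us: "w = code us" "xp us t v" by (auto simp: accepted_def)
  have "us \<noteq> []" using code_neq_Nil xpath_lpath us(2) by blast
  obtain z where z: "z \<in> DV w" using DV_nonempty assms(1) by blast
  then have zeq: "z = - 1 / 6 ^ (x + length us)" using DV_code[OF \<open>us \<noteq> []\<close>] us(1) by simp
  from assms(3) obtain q P where q: "gpath NT x w q P" "y = - of_nat (pot t q) / of_nat P"
    by (auto simp: path_values_def)
  have g: "good us t v q P" using valid_path us q(1) by blast
  have "z < y"
  proof (cases "q = Found")
    case True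
    then have "6 ^ (x + length us) < P" using g by (simp add: good_def)
    then have "(6::rat) ^ (x + length us) < of_nat P" by (metis of_nat_less_iff of_nat_numeral of_nat_power)
    then have "1 / of_nat P < 1 / (6::rat) ^ (x + length us)" by (intro divide_strict_left_mono) auto
    then show ?thesis using True q(2) zeq by simp
  next
    case False
    then have "pot t q = 0" using g by (cases q) (auto simp: good_def)
    then show ?thesis using q(2) zeq by simp
  qed
  with z show ?thesis by blast
qed

text \<open>If the edges misfit or end outside \<open>t\<close>, potential 2 meets the product
  \<open>6 ^ length w\<close>, which is at most the deterministic one. Otherwise the edges lead to
  \<open>t\<close> but cannot be executed, and a checker reaches \<open>Found\<close> with a smaller
  product.\<close>

lemma rejected_less:
  assumes "w \<noteq> []" "set w \<subseteq> letters E" "\<not> accepted w" "z \<in> DV w"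
  shows "\<exists>y\<in>NV w. y < z"
proof -
  have low: ?thesis if "gpath NT x w q (6 ^ length w)" "pot t q = 2" for q
  proof -
    have "- 2 / 6 ^ length w \<in> NV w" using that by (force simp: path_values_def)
    moreover have "- 2 / 6 ^ length w < (- 1 / 6 ^ length w :: rat)"
      by (intro divide_strict_right_mono) auto
    ultimately show ?thesis using DV_bound[OF assms(4)] by force
  qed
  from register_path[OF assms(1,2)] show ?thesis
  proof
    assume "gpath NT x w Bad (6 ^ length w)"
    then show ?thesis by (rule low) simp
  next
    assume "\<exists>us p. w = code us \<and> lp us p \<and> gpath NT x w (Reg p) (6 ^ length w)"
    then obtain us p where us: "w = code us" "lp us p" "gpath NT x w (Reg p) (6 ^ length w)" by blast
    show ?thesis
    proof (cases "p = t")
      case True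
      \<comment> \<open>After \<open>Sig\<close> alone the deterministic automaton is still in
        \<open>Start\<close>, with value 0; the formula of \<open>DV_code\<close> holds from the
        first edge on.\<close>
      then have "us \<noteq> []" using us(2) code_neq_Nil by blast
      have "\<nexists>v. xp us t v" using assms(3) us(1) by (auto simp: accepted_def)
      then obtain P where P: "gpath NT x w Found P" "P < 6 ^ (x + length us)"
        using failure_path[OF us(2)] True us(1) by blast
      have "P > 0" using P(1) by (induction rule: gpath.induct) (auto intro!: less_trans[OF _ fac_gt_1[OF x_pos]])
      have "(of_nat P :: rat) < 6 ^ (x + length us)"
        using P(2) by (metis of_nat_less_iff of_nat_numeral of_nat_power)
      then have "1 / (6::rat) ^ (x + length us) < 1 / of_nat P"
        using \<open>P > 0\<close> by (intro divide_strict_left_mono) auto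
      moreover have "- 1 / of_nat P \<in> NV w" using P(1) by (force simp: path_values_def)
      moreover have "z = - 1 / 6 ^ (x + length us)" using DV_code[OF \<open>us \<noteq> []\<close>] assms(4) us(1) by simp
      ultimately show ?thesis by (intro bexI[of _ "- 1 / of_nat P"]) auto
    next
      case False
      then show ?thesis using low[OF us(3)] by simp
    qed
  qed
qed

end

section \<open>Comparison instances of counter graphs\<close>

lemma desc_is_nmda:
  assumes "x > 0" "ls \<noteq> []" "Start \<in> set qs" "set ts \<subseteq> set qs \<times> set ls \<times> set qs"
    and "\<And>q a. q \<in> set qs \<Longrightarrow> a \<in> set ls \<Longrightarrow> \<exists>q'. (q, a, q') \<in> set ts"
  shows "is_nmda (nmda_of (desc x t ls qs ts))" "integral_nmda (nmda_of (desc x t ls qs ts))"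
proof -
  let ?A = "nmda_of (desc x t ls qs ts)"
  have disc: "\<exists>tr. discount ?A u = of_nat (fac x tr)" if "u \<in> transitions ?A" for u
    using that desc_weight(2)[of _ _ _ ts] by (fastforce simp: desc_simps(4))
  then show "integral_nmda ?A" unfolding integral_nmda_def by (metis Ints_of_nat)
  have "discount ?A u > 1" if "u \<in> transitions ?A" for u
  proof -
    from disc[OF that] obtain tr where "discount ?A u = of_nat (fac x tr)" by blast
    then show ?thesis using fac_gt_1[OF assms(1), of tr] by simp
  qed
  moreover have "transitions ?A \<subseteq> states ?A \<times> alphabet ?A \<times> states ?A"
    using assms(4) unfolding desc_simps by auto
  moreover have "\<exists>q'. (q, a, q') \<in> transitions ?A" if "q \<in> states ?A" "a \<in> alphabet ?A" for q a
  proof -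
    from that obtain p b where "p \<in> set qs" "b \<in> set ls" and eq: "q = to_nat p" "a = to_nat b"
      unfolding desc_simps by blast
    then obtain p' where "(p, b, p') \<in> set ts" using assms(5) by blast
    then have "(q, a, to_nat p') \<in> transitions ?A" unfolding desc_simps eq by force
    then show ?thesis ..
  qed
  ultimately show "is_nmda ?A" using assms(2,3) unfolding is_nmda_def by (auto simp: desc_simps(1-3))
qed

lemma desc_is_dmda:
  assumes "is_nmda (nmda_of (desc x t ls qs ts))"
    and "\<And>q a q1 q2. (q, a, q1) \<in> set ts \<Longrightarrow> (q, a, q2) \<in> set ts \<Longrightarrow> q1 = q2"
  shows "is_dmda (nmda_of (desc x t ls qs ts))"
  using assms unfolding is_dmda_def by (fastforce simp: desc_simps)

text \<open>The transitions whose factors depend on \<open>x\<close> come first, so that the code of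
  the list arises by consing onto the code of a list independent of \<open>x\<close>.\<close>

definition ndesc :: "nat \<Rightarrow> nat list \<Rightarrow> letter list \<Rightarrow> state list \<Rightarrow> trans list \<Rightarrow> nmda_desc" where
  "ndesc x t ls qs ts =
     desc x t ls qs ((Start, Sig, Up 0) # (Start, Sig, Dn 0) # (Start, Sig, Mid) # ts)"

definition ddesc :: "nat \<Rightarrow> nat list \<Rightarrow> letter list \<Rightarrow> trans list \<Rightarrow> nmda_desc" where
  "ddesc x t ls ts = desc x t ls [Start, Found] ((Start, Sig, Start) # ts)"

definition halts :: "edge set \<Rightarrow> nat list \<Rightarrow> nat list \<Rightarrow> nat \<Rightarrow> bool" where
  "halts E s t x \<longleftrightarrow> (\<exists>v. (gstep E)\<^sup>*\<^sup>* (s, (\<lambda>_. 0)(0 := x)) (t, v))"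

context counter_graph
begin

lemma succs_nstates:
  assumes "q \<in> nstates E s t K" "a \<in> letters E"
  shows "succs s K q a \<subseteq> nstates E s t K"
proof -
  have "Reg p' \<in> nstates E s t K" if "(p, i, p') \<in> E" for p i p'
  proof -
    have "p' \<in> (snd \<circ> snd) ` E" using imageI[OF that, of "snd \<circ> snd"] by simp
    then show ?thesis by (simp add: nstates_def)
  qed
  moreover have "{Up 0, Dn 0, Mid, Found, Bad, Reg s} \<union> Up ` {1..K} \<union> Dn ` {1..K} \<subseteq> nstates E s t K"
    by (auto simp: nstates_def)
  ultimately show ?thesis
    using assms by (cases "(s, K, q, a)" rule: succs.cases) (auto simp: letters_def)
qed

lemma succs_nonempty: "succs s K q a \<noteq> {}"
  using K_pos by (cases "(s, K, q, a)" rule: succs.cases) auto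

lemma finite_letters: "finite (letters E)"
  using finite_E by (simp add: letters_def)

lemma finite_nstates: "finite (nstates E s t K)"
  using finite_E by (simp add: nstates_def)

lemma finite_NT: "finite NT"
proof -
  have "NT \<subseteq> nstates E s t K \<times> letters E \<times> nstates E s t K"
    using succs_nstates by (auto simp: ntrans_def)
  then show ?thesis using finite_letters finite_nstates by (meson finite_SigmaI finite_subset)
qed

lemma finite_DT: "finite DT"
  using finite_E finite_letters by (simp add: dtrans_def)

context
  fixes ls qs ts ts'
  assumes ls: "set ls = letters E" and qs: "set qs = nstates E s t K"
    and ts: "set ts = NT - {(Start, Sig, Up 0), (Start, Sig, Dn 0), (Start, Sig, Mid)}"
    and ts': "set ts' = DT - {(Start, Sig, Start)}"
begin

lemma NT_eq: "set ((Start, Sig, Up 0) # (Start, Sig, Dn 0) # (Start, Sig, Mid) # ts) = NT"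
proof -
  have "{(Start, Sig, Up 0), (Start, Sig, Dn 0), (Start, Sig, Mid)} \<subseteq> NT"
    by (simp add: ntrans_def nstates_def letters_def)
  then show ?thesis unfolding list.set ts by blast
qed

lemma DT_eq: "set ((Start, Sig, Start) # ts') = DT"
proof -
  have "(Start, Sig, Start) \<in> DT" by (simp add: dtrans_def)
  then show ?thesis unfolding list.set ts' by blast
qed

abbreviation "Nd \<equiv> ndesc x t ls qs ts"
abbreviation "Dd \<equiv> ddesc x t ls ts'"

lemma comparison_instance: "(Nd, Dd) \<in> comparison_instances"
proof -
  have ne: "ls \<noteq> []" using ls by (auto simp: letters_def)
  have Start: "Start \<in> set qs" by (simp add: qs nstates_def)
  have "NT \<subseteq> set qs \<times> set ls \<times> set qs"
    using succs_nstates by (auto simp: ls qs ntrans_def)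
  moreover have "\<exists>q'. (q, a, q') \<in> NT" if "q \<in> set qs" "a \<in> set ls" for q a
    using that succs_nonempty[of q a] by (auto simp: ls qs ntrans_def)
  ultimately have Nd: "is_nmda (nmda_of Nd)" "integral_nmda (nmda_of Nd)"
    unfolding ndesc_def by (intro desc_is_nmda[OF x_pos ne Start]; unfold NT_eq; blast)+
  have "DT \<subseteq> set [Start, Found] \<times> set ls \<times> set [Start, Found]"
    by (auto simp: dtrans_def ls letters_def)
  moreover have "\<exists>q'. (q, a, q') \<in> DT" if "q \<in> set [Start, Found]" "a \<in> set ls" for q a
    using that by (auto simp: dtrans_def ls letters_def)
  ultimately have Dd: "is_nmda (nmda_of Dd)" "integral_nmda (nmda_of Dd)"
    using desc_is_nmda[OF x_pos ne, of "[Start, Found]" "(Start, Sig, Start) # ts'"]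
    unfolding DT_eq ddesc_def by simp_all
  moreover have "is_dmda (nmda_of Dd)"
    using Dd(1) unfolding ddesc_def
    by (rule desc_is_dmda; unfold DT_eq; auto simp: dtrans_def)
  moreover have "alphabet (nmda_of Nd) = alphabet (nmda_of Dd)"
    by (simp add: ndesc_def ddesc_def desc_simps)
  ultimately show ?thesis using Nd Dd by (simp add: comparison_instances_def)
qed

lemma words:
  "nonempty_words (alphabet (nmda_of Nd)) = map to_nat ` {w. w \<noteq> [] \<and> set w \<subseteq> letters E}"
proof -
  have "w \<in> map to_nat ` {w. w \<noteq> [] \<and> set w \<subseteq> letters E}"
    if "w \<noteq> []" "set w \<subseteq> to_nat ` letters E" for w :: "nat list"
  proof (rule image_eqI[of _ _ "map from_nat w"])
    show "w = map to_nat (map from_nat w :: letter list)"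
      using that(2) by (auto intro!: map_idI[symmetric])
    show "map from_nat w \<in> {w. w \<noteq> [] \<and> set w \<subseteq> letters E}" using that by auto
  qed
  then show ?thesis by (auto simp: nonempty_words_def ndesc_def desc_simps ls intro!: imageI)
qed

lemma word_value_N: "word_value (nmda_of Nd) (map to_nat w) = (INF y\<in>NV w. ereal (of_rat y))"
  unfolding ndesc_def word_value_desc NT_eq ..

lemma word_value_D: "word_value (nmda_of Dd) (map to_nat w) = (INF y\<in>DV w. ereal (of_rat y))"
  unfolding ddesc_def word_value_desc DT_eq ..

text \<open>The two values never coincide, so the strict and the nonstrict comparison have the same
  answer on every word.\<close>

lemma word_value_cases:
  assumes "w \<noteq> []" "set w \<subseteq> letters E"
  shows "if accepted w then word_value (nmda_of Dd) (map to_nat w) < word_value (nmda_of Nd) (map to_nat w)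
    else word_value (nmda_of Nd) (map to_nat w) < word_value (nmda_of Dd) (map to_nat w)"
proof -
  have fin: "finite (NV w)" "finite (DV w)" using finite_path_values finite_NT finite_DT by auto
  have "DV w \<noteq> {}" by (rule DV_nonempty[OF assms(2)])
  moreover have "NV w \<noteq> {}"
    using register_path[OF assms] by (auto simp: path_values_def)
  ultimately show ?thesis
    unfolding word_value_N word_value_D
    using accepted_greater[OF assms(2)] rejected_less[OF assms] fin by (auto intro!: INF_less_INF)
qed

lemma accepted_iff_halts: "(\<exists>w. w \<noteq> [] \<and> set w \<subseteq> letters E \<and> accepted w) \<longleftrightarrow> halts E s t x"
proof -
  have "set us \<subseteq> E" if "lp us p" for us p
    using that by induction auto
  then have "set (code us) \<subseteq> letters E" if "xp us p v" for us p v
    using xpath_lpath[OF that] by (auto simp: letters_def)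
  then show ?thesis unfolding halts_def gsteps_iff_xpath accepted_def by blast
qed

lemma comparison_iff:
  "(\<forall>w\<in>nonempty_words (alphabet (nmda_of Nd)). word_value (nmda_of Nd) w \<le> word_value (nmda_of Dd) w) \<longleftrightarrow>
     \<not> halts E s t x"
  "(\<forall>w\<in>nonempty_words (alphabet (nmda_of Nd)). word_value (nmda_of Nd) w < word_value (nmda_of Dd) w) \<longleftrightarrow>
     \<not> halts E s t x"
proof -
  have "word_value (nmda_of Nd) (map to_nat w) \<le> word_value (nmda_of Dd) (map to_nat w) \<longleftrightarrow> \<not> accepted w"
    "word_value (nmda_of Nd) (map to_nat w) < word_value (nmda_of Dd) (map to_nat w) \<longleftrightarrow> \<not> accepted w"
    if "w \<noteq> []" "set w \<subseteq> letters E" for w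
    using word_value_cases[OF that] by (cases "accepted w"; simp add: less_imp_le not_le)+
  then show
    "(\<forall>w\<in>nonempty_words (alphabet (nmda_of Nd)). word_value (nmda_of Nd) w \<le> word_value (nmda_of Dd) w) \<longleftrightarrow>
       \<not> halts E s t x"
    "(\<forall>w\<in>nonempty_words (alphabet (nmda_of Nd)). word_value (nmda_of Nd) w < word_value (nmda_of Dd) w) \<longleftrightarrow>
       \<not> halts E s t x"
    unfolding accepted_iff_halts[symmetric] words by auto
qed

end

end

section \<open>Diagonalisation\<close>

text \<open>The initial value \<open>x\<close> of counter 0 only occurs in the discount factors of four
  transitions; everything else is collected in \<open>l\<close>, \<open>q\<close>, \<open>r\<close> and \<open>r'\<close>.\<close>

definition sig_code :: "state \<Rightarrow> nat \<Rightarrow> nat \<Rightarrow> nat" where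
  "sig_code p c x = list_encode [to_nat Start, to_nat Sig, to_nat p, rat_code 0, rat_code (of_nat (c ^ x))]"

definition instance_code :: "nat \<Rightarrow> nat \<Rightarrow> nat \<Rightarrow> nat \<Rightarrow> nat \<Rightarrow> nat" where
  "instance_code l q r r' x = prod_encode
     (list_encode [l, q, list_encode [to_nat Start],
        cons_code (sig_code (Up 0) 4 x) (cons_code (sig_code (Dn 0) 9 x) (cons_code (sig_code Mid 6 x) r))],
      list_encode [l, list_encode (map to_nat [Start, Found]), list_encode [to_nat Start],
        cons_code (sig_code Start 6 x) r'])"

text \<open>The four numbers can be recovered by search since the packing is injective, and the
  outer \<open>cons_code\<close> makes the result positive, as required of the input
  \<open>x\<close>.\<close>

definition self_code :: "nat \<Rightarrow> nat \<Rightarrow> nat \<Rightarrow> nat \<Rightarrow> nat" where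
  "self_code l q r r' = cons_code l (prod_encode (q, prod_encode (r, r')))"

lemma recn_self_code: "recn 4 (\<lambda>xs. self_code (xs ! 0) (xs ! 1) (xs ! 2) (xs ! 3))"
  unfolding self_code_def
  by (intro recn_comp2[OF rec2_cons_code] recn_comp2[OF rec2_prod_encode] recn_nth; simp)

lemma rec1_sig_code: "rec1 (sig_code p c)"
  unfolding sig_code_def list_encode_Cons rat_code_of_nat
  by (rule rec1_recn)
    (intro recn_comp2[OF rec2_cons_code] recn_comp2[OF rec2_prod_encode] recn_comp1[OF rec1_mult]
      recn_comp1[OF rec1_power] recn_const recn_nth; simp)

lemma recn_instance_code:
  "recn 4 (\<lambda>xs. instance_code (xs ! 0) (xs ! 1) (xs ! 2) (xs ! 3)
     (self_code (xs ! 0) (xs ! 1) (xs ! 2) (xs ! 3)))"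
  unfolding instance_code_def list_encode_Cons
  by (intro recn_comp2[OF rec2_cons_code] recn_comp2[OF rec2_prod_encode] recn_comp1[OF rec1_sig_code]
      recn_self_code recn_const recn_nth; simp)

lemma self_code_inject:
  "self_code l q r r' = self_code l2 q2 r2 r2' \<longleftrightarrow> l = l2 \<and> q = q2 \<and> r = r2 \<and> r' = r2'"
  by (auto simp: self_code_def cons_code_def prod_encode_eq)

lemma entry_independent:
  assumes "tr \<notin> {Start} \<times> {Sig} \<times> (range Up \<union> range Dn \<union> {Mid, Start})"
  shows "entry x t tr = entry 1 t tr"
proof -
  obtain q a q' where "tr = (q, a, q')" by (cases tr)
  then show ?thesis using assms by (cases q; cases q') (auto simp: fac_def)
qed

text \<open>Separates the input from the rest of the description, so that the input may itself be
  computed from the codes of the rest.\<close>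

lemma pair_code_instance:
  assumes "\<And>tr. tr \<in> set ts \<union> set ts' \<Longrightarrow> entry x t tr = entry 1 t tr"
  shows "pair_code (ndesc x t ls qs ts, ddesc x t ls ts') =
    instance_code (list_encode (map to_nat ls)) (list_encode (map to_nat qs))
      (list_encode (map (entry_code \<circ> entry 1 t) ts)) (list_encode (map (entry_code \<circ> entry 1 t) ts')) x"
proof -
  have M: "map (entry_code \<circ> entry x t) ts = map (entry_code \<circ> entry 1 t) ts"
    "map (entry_code \<circ> entry x t) ts' = map (entry_code \<circ> entry 1 t) ts'" using assms by auto
  \<comment> \<open>The four transitions taken out join states of potential 0 and hence have weight
    0, in accordance with \<open>sig_code\<close>.\<close>
  show ?thesis
    by (simp add: M ndesc_def ddesc_def desc_def instance_code_def sig_code_def cons_code_def fac_def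
        del: of_nat_power)
qed

section \<open>Guessing and testing with counters\<close>

lemma star_Inc_iff: "(exec (Inc k))\<^sup>*\<^sup>* v v' \<longleftrightarrow> (\<exists>n. v' = v(k := v k + n))"
proof
  assume "(exec (Inc k))\<^sup>*\<^sup>* v v'"
  then show "\<exists>n. v' = v(k := v k + n)"
  proof (induction rule: rtranclp_induct)
    case base
    show ?case by (rule exI[of _ 0]) simp
  next
    case (step y z)
    then obtain n where "y = v(k := v k + n)" by blast
    with step.hyps(2) show ?case by (intro exI[of _ "Suc n"]) simp
  qed
next
  have star: "(exec (Inc k))\<^sup>*\<^sup>* v (v(k := v k + n))" for n
  proof (induction n)
    case (Suc n)
    have *: "exec (Inc k) (v(k := v k + n)) (v(k := v k + Suc n))" by simp
    show ?case by (rule rtranclp.rtrancl_into_rtrancl[of "exec (Inc k)", OF Suc *])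
  qed simp
  assume "\<exists>n. v' = v(k := v k + n)"
  then show "(exec (Inc k))\<^sup>*\<^sup>* v v'" using star by blast
qed

text \<open>A subtraction that blocks when it would become negative; followed by a zero test of
  \<open>b\<close>, it becomes an equality test.\<close>

lemma loop_Dec_iff:
  assumes "a \<noteq> b"
  shows "loop a (exec (Dec b)) v v' \<longleftrightarrow> v a \<le> v b \<and> v' = v(a := 0, b := v b - v a)"
proof -
  let ?X = "\<lambda>j. {u. j \<le> v b \<and> u = v(a := v a - j, b := v b - j)}"
  have "loop a (exec (Dec b)) v v' \<longleftrightarrow> v' \<in> ?X (v a)"
  proof (rule loop_iff[where X = ?X])
    show "(\<exists>u\<in>?X j. exec (Dec b) (u(a := v a - Suc j)) u') \<longleftrightarrow> u' \<in> ?X (Suc j)" for j u'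
    proof -
      have "(v(a := v a - j, b := v b - j, a := v a - Suc j))(b := v b - j - 1) =
          v(a := v a - Suc j, b := v b - Suc j)"
        using assms by (auto simp: fun_eq_iff)
      then show ?thesis using assms by auto
    qed
  qed (use assms in auto)
  then show ?thesis by auto
qed

text \<open>The input is decoded by guessing the components and recomputing their code.\<close>

lemma diagonal_machine:
  obtains R where "implementable R"
    "\<And>x. (\<exists>v. R ((\<lambda>_. 0)(0 := x)) v) \<longleftrightarrow>
       (\<exists>l q r r' y. x = self_code l q r r' \<and> rec_eval f [instance_code l q r r' x] y \<and> y > 0)"
proof -
  obtain e where e: "\<And>xs. length xs = 4 \<Longrightarrow> rec_eval e xs (self_code (xs ! 0) (xs ! 1) (xs ! 2) (xs ! 3))"
    using recn_self_code unfolding recn_def by blast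
  obtain h where h: "\<And>xs. length xs = 4 \<Longrightarrow> rec_eval h xs (instance_code (xs ! 0) (xs ! 1) (xs ! 2) (xs ! 3)
      (self_code (xs ! 0) (xs ! 1) (xs ! 2) (xs ! 3)))"
    using recn_instance_code unfolding recn_def by blast
  define inst where "inst l q r r' = instance_code l q r r' (self_code l q r r')" for l q r r'
  have e_iff: "rec_eval e [l, q, r, r'] y \<longleftrightarrow> y = self_code l q r r'" for l q r r' y
    using e[of "[l, q, r, r']"] rec_eval_deterministic by (auto simp: numeral_eq_Suc)
  have h_iff: "rec_eval h [l, q, r, r'] y \<longleftrightarrow> y = inst l q r r'" for l q r r' y
    using h[of "[l, q, r, r']"] rec_eval_deterministic by (auto simp: numeral_eq_Suc inst_def)
  have fh_iff: "rec_eval (Comp f [h]) [l, q, r, r'] y \<longleftrightarrow> rec_eval f [inst l q r r'] y" for l q r r' y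
    by (auto simp: rec_eval_Comp_iff list_all2_Cons1 h_iff)
  \<comment> \<open>Register 0 holds the input, 1 to 4 the guesses, 5 their code and 6 the answer of
    \<open>f\<close>; scratch space starts at 7.\<close>
  have "allocatable [1, 2, 3, 4] 5 7" "allocatable [1, 2, 3, 4] 6 7" by (simp_all add: allocatable_def)
  then obtain S T where S: "computes e [1, 2, 3, 4] 5 7 S" and T: "computes (Comp f [h]) [1, 2, 3, 4] 6 7 T"
    using compilableE[OF _ compilable] by metis
  define G where "G = (exec (Inc 1))\<^sup>*\<^sup>* OO (exec (Inc 2))\<^sup>*\<^sup>* OO (exec (Inc 3))\<^sup>*\<^sup>* OO (exec (Inc 4))\<^sup>*\<^sup>*"
  \<comment> \<open>The first two parts check that the recomputed code equals the input, the last
    one that the answer is positive. If either fails, the graph blocks.\<close>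
  define C where "C = loop 0 (exec (Dec 5)) OO exec (Zer 5) OO exec (Dec 6)"
  have impl: "implementable (G OO S OO T OO C)"
    unfolding G_def C_def using S T
    by (intro implementable_seq implementable_star implementable_loop implementable_instr)
      (auto intro: computes_implementable)
  have C_iff: "(\<exists>v'. C v v') \<longleftrightarrow> v 0 = v 5 \<and> v 6 > 0" for v
    by (auto simp: C_def relcompp_apply loop_Dec_iff)
  define st where "st x l q r r' = ((\<lambda>_. 0)(0 := x, 1 := l, 2 := q, 3 := r, 4 := r') :: store)"
    for x l q r r' :: nat
  have G_iff: "G ((\<lambda>_. 0)(0 := x)) u \<longleftrightarrow> (\<exists>l q r r'. u = st x l q r r')" for x u
  proof -
    have ex_eq: "(\<exists>w. (\<exists>n. w = F n) \<and> P w) \<longleftrightarrow> (\<exists>n. P (F n))" for F :: "nat \<Rightarrow> store" and P by blast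
    show ?thesis unfolding G_def relcompp_apply star_Inc_iff ex_eq by (simp add: st_def)
  qed
  have rest: "(\<exists>v. (S OO T OO C) (st x l q r r') v) \<longleftrightarrow>
      x = self_code l q r r' \<and> (\<exists>y>0. rec_eval f [inst l q r r'] y)" for x l q r r'
  proof -
    let ?u = "(st x l q r r')(5 := self_code l q r r')"
    have "S (st x l q r r') u \<longleftrightarrow> u = ?u" for u
      using computes_iff[OF S, of "st x l q r r'" u] by (simp add: st_def e_iff)
    moreover have "T ?u u \<longleftrightarrow> (\<exists>y. rec_eval f [inst l q r r'] y \<and> u = ?u(6 := y))" for u
      using computes_iff[OF T, of ?u u] by (simp add: st_def fh_iff)
    ultimately have "(\<exists>v. (S OO T OO C) (st x l q r r') v) \<longleftrightarrow>
        (\<exists>y. rec_eval f [inst l q r r'] y \<and> (\<exists>v. C (?u(6 := y)) v))"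
      unfolding relcompp_apply by (simp only: ex_simps simp_thms) blast
    also have "\<dots> \<longleftrightarrow> x = self_code l q r r' \<and> (\<exists>y>0. rec_eval f [inst l q r r'] y)"
      unfolding C_iff by (auto simp: st_def)
    finally show ?thesis .
  qed
  have "(\<exists>v. (G OO S OO T OO C) ((\<lambda>_. 0)(0 := x)) v) \<longleftrightarrow>
      (\<exists>l q r r'. \<exists>v. (S OO T OO C) (st x l q r r') v)" for x
    unfolding relcompp_apply[of G] G_iff by blast
  moreover have "(\<exists>v. (S OO T OO C) (st x l q r r') v) \<longleftrightarrow>
      (\<exists>y. x = self_code l q r r' \<and> rec_eval f [instance_code l q r r' x] y \<and> y > 0)" for x l q r r'
    unfolding rest inst_def by auto
  ultimately show thesis using that[OF impl] by presburger
qed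

text \<open>On its own code \<open>x\<close> the graph asks \<open>f\<close> about the instance
  formed from itself and \<open>x\<close>, and halts iff the answer is positive, that is, iff it
  does not halt. The parameter \<open>yes\<close> covers both comparison problems.\<close>

lemma undecidable_if_not_halts:
  assumes yes: "\<And>E s t K x ls qs ts ts'. counter_graph E s t K x \<Longrightarrow> set ls = letters E \<Longrightarrow>
    set qs = nstates E s t K \<Longrightarrow>
    set ts = ntrans E s t K - {(Start, Sig, Up 0), (Start, Sig, Dn 0), (Start, Sig, Mid)} \<Longrightarrow>
    set ts' = dtrans E - {(Start, Sig, Start)} \<Longrightarrow>
    (ndesc x t ls qs ts, ddesc x t ls ts') \<in> yes \<longleftrightarrow> \<not> halts E s t x"
  shows "\<not> decidable pair_code comparison_instances yes"
proof
  assume "decidable pair_code comparison_instances yes"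
  then obtain f where f: "\<And>i. i \<in> comparison_instances \<Longrightarrow> rec_eval f [pair_code i] (if i \<in> yes then 1 else 0)"
    unfolding decidable_def by blast
  obtain R where R: "implementable R" "\<And>x. (\<exists>v. R ((\<lambda>_. 0)(0 := x)) v) \<longleftrightarrow>
       (\<exists>l q r r' y. x = self_code l q r r' \<and> rec_eval f [instance_code l q r r' x] y \<and> y > 0)"
    using diagonal_machine by metis
  obtain E s t where E: "finite E" "s \<noteq> t" "\<And>i q. (s, i, q) \<in> E \<Longrightarrow> i = Nop"
    "\<And>v v'. (gstep E)\<^sup>*\<^sup>* (s, v) (t, v') \<longleftrightarrow> R v v'"
    using implementable_normal_form[OF R(1)] by metis
  \<comment> \<open>Finitely many edges involve finitely many counters, which gives the bound
    \<open>K\<close>; its successor is used below to have a positive one.\<close>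
  have "finite (\<Union>(p, i, q)\<in>E. {k. i = Dec k \<or> i = Zer k})"
  proof (intro finite_UN_I E(1))
    have "{k. i = Dec k \<or> i = Zer k} \<subseteq> (case i of Dec k \<Rightarrow> {k} | Zer k \<Rightarrow> {k} | _ \<Rightarrow> {})" for i
      by (cases i) auto
    then have "finite {k. i = Dec k \<or> i = Zer k}" for i
      by (rule finite_subset) (auto split: instr.split)
    then show "finite (case e of (p, i, q) \<Rightarrow> {k. i = Dec k \<or> i = Zer k})" for e :: edge
      by (simp split: prod.split)
  qed
  then obtain K where K: "\<forall>k\<in>(\<Union>(p, i, q)\<in>E. {k. i = Dec k \<or> i = Zer k}). k \<le> K"
    unfolding finite_nat_set_iff_bounded_le by (elim exE)
  have graph: "counter_graph E s t (Suc K) x" if "x > 0" for x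
  proof
    show "k \<le> Suc K" if "(p, Dec k, q) \<in> E" for p k q using that by (intro le_SucI bspec[OF K]) auto
    show "k \<le> Suc K" if "(p, Zer k, q) \<in> E" for p k q using that by (intro le_SucI bspec[OF K]) auto
  qed (use E that in auto)
  interpret one: counter_graph E s t "Suc K" 1 by (rule graph) simp
  \<comment> \<open>The sets of letters, states and transitions do not depend on the input, so lists
    obtained for input 1 also serve for \<open>x\<close>, which is defined from them.\<close>
  obtain ls qs ts ts' where lists: "set ls = letters E" "set qs = nstates E s t (Suc K)"
    "set ts = ntrans E s t (Suc K) - {(Start, Sig, Up 0), (Start, Sig, Dn 0), (Start, Sig, Mid)}"
    "set ts' = dtrans E - {(Start, Sig, Start)}"
    using one.finite_letters one.finite_nstates one.finite_NT one.finite_DT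
    by (metis finite_Diff finite_list)
  define l q r r' where "l = list_encode (map to_nat ls)" "q = list_encode (map to_nat qs)"
    "r = list_encode (map (entry_code \<circ> entry 1 t) ts)" "r' = list_encode (map (entry_code \<circ> entry 1 t) ts')"
  note codes = this
  define x where "x = self_code l q r r'"
  have "x > 0" by (simp add: x_def self_code_def cons_code_def)
  interpret counter_graph E s t "Suc K" x using \<open>x > 0\<close> by (rule graph)
  let ?i = "(ndesc x t ls qs ts, ddesc x t ls ts')"
  have "pair_code ?i = instance_code l q r r' x"
    unfolding codes
  proof (rule pair_code_instance, rule entry_independent)
    fix tr assume "tr \<in> set ts \<union> set ts'"
    then show "tr \<notin> {Start} \<times> {Sig} \<times> (range Up \<union> range Dn \<union> {Mid, Start})"
      unfolding lists by (auto simp: ntrans_def dtrans_def)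
  qed
  then have eval: "rec_eval f [instance_code l q r r' x] (if ?i \<in> yes then 1 else 0)"
    using f[OF comparison_instance[OF lists]] by simp
  have "halts E s t x \<longleftrightarrow>
      (\<exists>l q r r' y. x = self_code l q r r' \<and> rec_eval f [instance_code l q r r' x] y \<and> y > 0)"
    unfolding halts_def E(4) by (rule R(2))
  also have "\<dots> \<longleftrightarrow> (\<exists>y>0. rec_eval f [instance_code l q r r' x] y)"
    unfolding x_def self_code_inject by blast
  also have "\<dots> \<longleftrightarrow> ?i \<in> yes"
    using eval rec_eval_deterministic[OF eval] by (auto split: if_splits)
  finally show False using yes[OF counter_graph_axioms lists] by blast
qed

theorem theorem3p5:
  shows "\<not> decidable pair_code comparison_instances
            {(N, D). \<forall>w\<in>nonempty_words (alphabet (nmda_of N)).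
                       word_value (nmda_of N) w \<le> word_value (nmda_of D) w} \<and>
         \<not> decidable pair_code comparison_instances
            {(N, D). \<forall>w\<in>nonempty_words (alphabet (nmda_of N)).
                       word_value (nmda_of N) w < word_value (nmda_of D) w}"
  by (intro conjI undecidable_if_not_halts) (simp_all add: counter_graph.comparison_iff)

end
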